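(* There exists $\tilde\epsilon=\tilde\epsilon(n)>0$, sufficiently small, such that the following holds. Let $g\in\mathcal M^\infty(\mathbb R^n,(0,\infty))\cap\mathcal M^0_{loc}(\mathbb R^n,[0,\infty))$ be a solution to the $h$-flow with initial metric $g_0$. Assume that $g(t)$ is $\tilde\epsilon(n)$-close to the standard metric $h$ for all $t\ge0$, and that $g_0$ is $\epsilon(r)$-close to $h$ on $\mathbb R^n\setminus B_r(0)$ with $\epsilon(r)\to0$ as $r\to\infty$. Then $g(t)\to h$ in $C^\infty$ as $t\to\infty$, that is, $$\sup_{\mathbb R^n}|g(t)-h|\to0\quad\text{as }t\to\infty,$$ and $$\sup_{\mathbb R^n}\left|{}^h\nabla^k g(t)\right|\to0\quad\text{as }t\to\infty\text{ for all }k\in\{1,2,\ldots\}.$$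
   Context: $h$ is the standard Euclidean metric on $\mathbb R^n$, $h_{ij}=\delta_{ij}$; ${}^h\nabla$ is its covariant derivative (i.e. partial derivatives) and norms $|\cdot|$ are taken with respect to $h$. $B_r(0)$ is the Euclidean ball of radius $r$ centered at $0$. For Riemannian metrics $g_1,g_2$ on a set, $g_1$ is $\epsilon$-close to $g_2$ if $(1+\epsilon)^{-1}g_2\le g_1\le(1+\epsilon)g_2$ pointwise as quadratic forms. The $h$-flow with initial metric $g_0$ is $\partial_t g_{ij}=-2R_{ij}+\nabla_iV_j+\nabla_jV_i$ for $t>0$, with $g(t)\to g_0$ in $C^0_{loc}(\mathbb R^n)$ as $t\searrow0$, where $R_{ij}$ and $\nabla$ are the Ricci tensor and Levi-Civita connection of $g(t)$, and $V_i=g_{ik}\left({}^g\Gamma^k_{rs}-{}^h\Gamma^k_{rs}\right)g^{rs}$, with ${}^g\Gamma$, ${}^h\Gamma$ the Christoffel symbols of $g(t)$ and $h$ (here ${}^h\Gamma=0$ in standard coordinates). Function spaces: for an interval $I$, $\mathcal M^k(\mathbb R^n,I)$ is the space of families $(g(t))_{t\in I}$ of Riemannian metrics on $\mathbb R^n$ which are $C^k$ on $\mathbb R^n\times I$, where $C^k$ on a non-compact set denotes the space in which derivatives of order up to $k$ are in $L^\infty$ on that set; $\mathcal M^\infty(\mathbb R^n,I)$ is defined similarly with $C^\infty$ (so all derivatives are in $L^\infty$ on $\mathbb R^n\times I$), and $\mathcal M^k_{loc}(\mathbb R^n,I)$ similarly with $C^k_{loc}$ (no global bounds required). In particular $\mathcal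 M^0_{loc}(\mathbb R^n,[0,\infty))$ consists of the families of Riemannian metrics that are continuous on $\mathbb R^n\times[0,\infty)$. *)

theory Defs
  imports "HOL-Analysis.Analysis"
begin

section \<open>Function spaces\<close>

text \<open>Derivatives are taken within \<open>S\<close>, so that they are one-sided at boundary points of
  \<open>S = UNIV \<times> I\<close> when the interval \<open>I\<close> is not open.\<close>

fun iter_deriv ::
  "'a::euclidean_space set \<Rightarrow> 'a list \<Rightarrow> ('a \<Rightarrow> 'b::real_normed_vector) \<Rightarrow> 'a \<Rightarrow> 'b" where
  "iter_deriv S [] f = f"
| "iter_deriv S (v # vs) f = (\<lambda>p. frechet_derivative (iter_deriv S vs f) (at p within S) v)"

definition Ck_loc_on ::
  "enat \<Rightarrow> 'a::euclidean_space set \<Rightarrow> ('a \<Rightarrow> 'b::real_normed_vector) \<Rightarrow> bool" where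
  "Ck_loc_on k S f \<longleftrightarrow>
    (\<forall>vs. set vs \<subseteq> Basis \<and> enat (length vs) \<le> k \<longrightarrow>
      continuous_on S (iter_deriv S vs f) \<and>
      (enat (length vs) < k \<longrightarrow> iter_deriv S vs f differentiable_on S))"

text \<open>As all derivatives of order at most \<open>k\<close> are continuous, being in \<open>L\<^sup>\<infinity>\<close> means being bounded.\<close>

definition Ck_on ::
  "enat \<Rightarrow> 'a::euclidean_space set \<Rightarrow> ('a \<Rightarrow> 'b::real_normed_vector) \<Rightarrow> bool" where
  "Ck_on k S f \<longleftrightarrow> Ck_loc_on k S f \<and>
    (\<forall>vs. set vs \<subseteq> Basis \<and> enat (length vs) \<le> k \<longrightarrow> bounded (iter_deriv S vs f ` S))"

section \<open>Metrics\<close>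

text \<open>A symmetric 2-tensor field on \<open>\<real>\<^sup>n\<close> is given by its matrix in standard coordinates. The norm
  of the type \<open>real^'n^'n\<close> is then the tensor norm with respect to the Euclidean metric.\<close>

type_synonym 'n tensor_field = "real^'n \<Rightarrow> real^'n^'n"

definition std_metric :: "'n::finite tensor_field" where
  "std_metric x = mat 1"

text \<open>Only the pointwise conditions; regularity is imposed by \<open>metrics\<close> and \<open>metrics_loc\<close>.\<close>

definition riemannian_metric :: "'n::finite tensor_field \<Rightarrow> bool" where
  "riemannian_metric g \<longleftrightarrow>
    (\<forall>x. transpose (g x) = g x \<and> (\<forall>v. v \<noteq> 0 \<longrightarrow> v \<bullet> (g x *v v) > 0))"

definition metrics :: "enat \<Rightarrow> real set \<Rightarrow> (real \<Rightarrow> 'n::finite tensor_field) set" where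
  "metrics k I =
    {g. (\<forall>t\<in>I. riemannian_metric (g t)) \<and> Ck_on k (UNIV \<times> I) (\<lambda>(x, t). g t x)}"

definition metrics_loc :: "enat \<Rightarrow> real set \<Rightarrow> (real \<Rightarrow> 'n::finite tensor_field) set" where
  "metrics_loc k I =
    {g. (\<forall>t\<in>I. riemannian_metric (g t)) \<and> Ck_loc_on k (UNIV \<times> I) (\<lambda>(x, t). g t x)}"

definition close_on ::
  "(real^'n::finite) set \<Rightarrow> real \<Rightarrow> 'n tensor_field \<Rightarrow> 'n tensor_field \<Rightarrow> bool" where
  "close_on A \<epsilon> g\<^sub>1 g\<^sub>2 \<longleftrightarrow>
    (\<forall>x\<in>A. \<forall>v. inverse (1 + \<epsilon>) * (v \<bullet> (g\<^sub>2 x *v v)) \<le> v \<bullet> (g\<^sub>1 x *v v) \<and>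
               v \<bullet> (g\<^sub>1 x *v v) \<le> (1 + \<epsilon>) * (v \<bullet> (g\<^sub>2 x *v v)))"

text \<open>The norm of the \<open>k\<close>-th covariant derivative of \<open>g\<close> with respect to the Euclidean metric, i.e.
  of the tensor whose components are all \<open>k\<close>-th order partial derivatives of the components of \<open>g\<close>.\<close>

definition norm_nabla :: "nat \<Rightarrow> 'n::finite tensor_field \<Rightarrow> real^'n \<Rightarrow> real" where
  "norm_nabla k g x =
    sqrt (\<Sum>vs | set vs \<subseteq> Basis \<and> length vs = k. (norm (iter_deriv UNIV vs g x))\<^sup>2)"

section \<open>The flow\<close>

definition partial :: "'n::finite \<Rightarrow> (real^'n \<Rightarrow> real) \<Rightarrow> real^'n \<Rightarrow> real" where
  "partial i f x = frechet_derivative f (at x) (axis i 1)"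

text \<open>\<open>christoffel g k i j\<close> is \<open>\<Gamma>\<close> with upper index \<open>k\<close> and lower indices \<open>i\<close>, \<open>j\<close>.\<close>

definition christoffel :: "'n::finite tensor_field \<Rightarrow> 'n \<Rightarrow> 'n \<Rightarrow> 'n \<Rightarrow> real^'n \<Rightarrow> real" where
  "christoffel g k i j x =
    (1/2) * (\<Sum>l\<in>UNIV. matrix_inv (g x) $ k $ l *
      (partial i (\<lambda>y. g y $ j $ l) x + partial j (\<lambda>y. g y $ i $ l) x
        - partial l (\<lambda>y. g y $ i $ j) x))"

text \<open>The sign is such that round spheres have positive Ricci curvature.\<close>

definition ricci :: "'n::finite tensor_field \<Rightarrow> 'n \<Rightarrow> 'n \<Rightarrow> real^'n \<Rightarrow> real" where
  "ricci g i j x =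
    (\<Sum>k\<in>UNIV. partial k (christoffel g k i j) x - partial i (christoffel g k k j) x
      + (\<Sum>l\<in>UNIV. christoffel g k k l x * christoffel g l i j x
                  - christoffel g k i l x * christoffel g l k j x))"

text \<open>The covariant derivative \<open>\<nabla>\<^sub>i V\<^sub>j\<close> of a 1-form \<open>V\<close>.\<close>

definition nabla1 ::
  "'n::finite tensor_field \<Rightarrow> 'n \<Rightarrow> ('n \<Rightarrow> real^'n \<Rightarrow> real) \<Rightarrow> 'n \<Rightarrow> real^'n \<Rightarrow> real" where
  "nabla1 g i V j x = partial i (V j) x - (\<Sum>k\<in>UNIV. christoffel g k i j x * V k x)"

definition deturck_form ::
  "'n::finite tensor_field \<Rightarrow> 'n tensor_field \<Rightarrow> 'n \<Rightarrow> real^'n \<Rightarrow> real" where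
  "deturck_form h g i x =
    (\<Sum>k\<in>UNIV. \<Sum>r\<in>UNIV. \<Sum>s\<in>UNIV.
      g x $ i $ k * (christoffel g k r s x - christoffel h k r s x) * matrix_inv (g x) $ r $ s)"

definition h_flow ::
  "'n::finite tensor_field \<Rightarrow> 'n tensor_field \<Rightarrow> (real \<Rightarrow> 'n tensor_field) \<Rightarrow> bool" where
  "h_flow h g\<^sub>0 g \<longleftrightarrow>
    (\<forall>t>0. \<forall>x i j.
      ((\<lambda>s. g s x $ i $ j) has_real_derivative
        - 2 * ricci (g t) i j x
        + nabla1 (g t) i (deturck_form h (g t)) j x
        + nabla1 (g t) j (deturck_form h (g t)) i x) (at t)) \<and>
    (\<forall>K. compact K \<longrightarrow> uniform_limit K g g\<^sub>0 (at_right 0))"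

end

theory Submission
  imports Defs
begin

text \<open>The theorem follows from the maximum principle together with one interpolation inequality.

Let \<open>u = |g - h|\<^sup>2\<close>. In standard coordinates the Ricci term and the DeTurck term combine to \<open>\<partial>\<^sub>t
g\<^sub>i\<^sub>j = g\<^sup>k\<^sup>l \<partial>\<^sub>k \<partial>\<^sub>l g\<^sub>i\<^sub>j + Q\<^sub>i\<^sub>j\<close>, where \<open>Q\<close> is quadratic in the first derivatives of \<open>g\<close>
with coefficients that are bounded as long as \<open>g\<close> is close to \<open>h\<close> (\<open>flow_velocity_eq\<close>,
\<open>quad_bound\<close>). Differentiating \<open>u\<close> twice produces the good term \<open>2 g\<^sup>k\<^sup>l \<langle>\<partial>\<^sub>k g, \<partial>\<^sub>l g\<rangle> \<ge> |\<partial>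
g|\<^sup>2\<close>, whereas \<open>Q\<close> enters \<open>\<partial>\<^sub>t u\<close> only multiplied by \<open>g - h\<close>. If \<open>g\<close> is close enough to \<open>h\<close>,
depending on \<open>n\<close> only, the good term wins and \<open>u\<close> is a subsolution, \<open>\<partial>\<^sub>t u \<le> g\<^sup>k\<^sup>l \<partial>\<^sub>k \<partial>\<^sub>l u\<close>
(\<open>dist_sq_subsolution\<close>).

Equations of this form, with uniformly elliptic but otherwise arbitrary coefficients, have
supersolutions \<open>(1 + t) powr (- \<alpha>) * exp (- |x|\<^sup>2 / (4 \<beta> (1 + t)))\<close> for suitable \<open>\<alpha>, \<beta> > 0\<close>
depending on the ellipticity constants. Since \<open>g\<^sub>0\<close> approaches \<open>h\<close> at infinity, the initial
value of \<open>u\<close> lies below \<open>\<delta>\<close> plus a multiple of such a barrier, for each \<open>\<delta> > 0\<close>. By the maximum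
principle this persists, and as the barrier decays uniformly, \<open>sup u\<close> is eventually below \<open>2 \<delta>\<close>
(\<open>subsolution_decay\<close>).

All derivatives of \<open>g\<close> are bounded uniformly in space and time because \<open>g\<close> lies in the global
class \<open>metrics \<infinity>\<close>. The inequality \<open>|f'| \<le> 2 sup |f| / s + s sup |f''|\<close>, applied inductively,
therefore carries the uniform decay from \<open>g - h\<close> to its derivatives of each order
(\<open>derivatives_tendsto_zero\<close>).\<close>

section \<open>Symmetric matrices\<close>

lemma inner_matrix_vector: "v \<bullet> (A *v w) = (\<Sum>i\<in>UNIV. \<Sum>j\<in>UNIV. v $ i * A $ i $ j * w $ j)"
  for A :: "real^'n::finite^'n"
  by (simp add: inner_vec_def matrix_vector_mult_def sum_distrib_left mult.assoc)

lemma inner_axis_matrix_axis: "axis i 1 \<bullet> (A *v axis j 1) = A $ i $ j"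
  for A :: "real^'n::finite^'n"
  by (simp add: inner_axis' matrix_vector_mul_component inner_axis)

lemma inner_matrix_commute:
  fixes A :: "real^'n::finite^'n"
  assumes "transpose A = A"
  shows "v \<bullet> (A *v w) = w \<bullet> (A *v v)"
  by (metis assms dot_lmul_matrix inner_commute transpose_matrix_vector)

text \<open>Induction on the number of nonzero diagonal entries: subtracting a suitable rank-one
matrix leaves a positive semidefinite matrix with fewer nonzero diagonal entries, and a positive
semidefinite matrix with zero diagonal vanishes.\<close>

lemma psd_sum_of_squares:
  fixes A :: "real^'n::finite^'n"
  assumes "transpose A = A" and "\<And>v. 0 \<le> v \<bullet> (A *v v)"
  shows "\<exists>ws :: (real^'n) list. \<forall>i j. A $ i $ j = (\<Sum>w\<leftarrow>ws. w $ i * w $ j)"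
  using assms
proof (induction "card {i. A $ i $ i \<noteq> 0}" arbitrary: A rule: less_induct)
  case less
  have sym: "A $ p $ q = A $ q $ p" for p q
    using less.prems(1) by (metis transpose_def vec_lambda_beta)
  have expand: "(v + c *\<^sub>R axis i 1) \<bullet> (A *v (v + c *\<^sub>R axis i 1))
      = v \<bullet> (A *v v) + 2 * c * (v \<bullet> (A *v axis i 1)) + c\<^sup>2 * A $ i $ i" for v c i
    using inner_matrix_commute[OF less.prems(1), of "axis i 1" v]
    by (simp add: matrix_vector_right_distrib inner_add_left inner_add_right
        inner_axis_matrix_axis matrix_vector_mult_scaleR power2_eq_square algebra_simps)
  show ?case
  proof (cases "\<exists>i. A $ i $ i \<noteq> 0")
    case False
    have "A $ p $ q = 0" for p q
    proof -
      have "0 \<le> (axis p 1 + c *\<^sub>R axis q 1) \<bullet> (A *v (axis p 1 + c *\<^sub>R axis q 1))" for c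
        by (rule less.prems(2))
      then have "0 \<le> 2 * c * A $ p $ q" for c
        unfolding expand using False by (simp add: inner_axis_matrix_axis)
      from this[of 1] this[of "-1"] show ?thesis by simp
    qed
    then show ?thesis by (intro exI[of _ "[]"]) simp
  next
    case True
    then obtain i where i: "A $ i $ i \<noteq> 0" by blast
    have "0 \<le> A $ i $ i"
      using less.prems(2)[of "axis i 1"] by (simp add: inner_axis_matrix_axis)
    with i have pos: "0 < A $ i $ i" by simp
    \<comment> \<open>This vector clears the \<open>i\<close>-th row and column, as in a Cholesky step; zero diagonal entries
        stay zero.\<close>
    define r where "r = sqrt (A $ i $ i)"
    have r: "r * r = A $ i $ i" "r > 0" using pos by (simp_all add: r_def)
    define w :: "real^'n" where "w = (\<chi> p. A $ p $ i / r)"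
    define A' :: "real^'n^'n" where "A' = (\<chi> p q. A $ p $ q - w $ p * w $ q)"
    have A'_form: "v \<bullet> (A' *v v) = v \<bullet> (A *v v) - (v \<bullet> w)\<^sup>2" for v
      unfolding inner_matrix_vector unfolding inner_vec_def
      by (simp add: A'_def power2_eq_square sum_product algebra_simps sum_subtractf)
    have vw: "v \<bullet> w = (v \<bullet> (A *v axis i 1)) / r" for v
      by (simp add: w_def inner_vec_def matrix_vector_mult_basis column_def sum_divide_distrib)
    have psd': "0 \<le> v \<bullet> (A' *v v)" for v
    proof -
      define b where "b = v \<bullet> (A *v axis i 1)"
      \<comment> \<open>The multiple of \<open>axis i 1\<close> minimises the form along that direction.\<close>
      have "0 \<le> (v + (- b / A $ i $ i) *\<^sub>R axis i 1) \<bullet> (A *v (v + (- b / A $ i $ i) *\<^sub>R axis i 1))"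
        by (rule less.prems(2))
      also have "\<dots> = v \<bullet> (A *v v) - b\<^sup>2 / A $ i $ i"
        unfolding expand b_def[symmetric] using pos
        by (simp add: field_simps power2_eq_square)
      also have "\<dots> = v \<bullet> (A' *v v)"
        unfolding A'_form vw b_def[symmetric] using r
        by (simp add: power_divide power2_eq_square[of r])
      finally show ?thesis .
    qed
    have sym': "transpose A' = A'"
      using sym by (simp add: transpose_def A'_def vec_eq_iff mult.commute)
    have diag: "A' $ p $ p = A $ p $ p - (w $ p)\<^sup>2" for p
      by (simp add: A'_def power2_eq_square)
    have "{p. A' $ p $ p \<noteq> 0} \<subset> {p. A $ p $ p \<noteq> 0}"
    proof
      have "A' $ p $ p = 0" if "A $ p $ p = 0" for p
        using psd'[of "axis p 1"] that
        by (simp add: inner_axis_matrix_axis diag)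
      then show "{p. A' $ p $ p \<noteq> 0} \<subseteq> {p. A $ p $ p \<noteq> 0}" by blast
      have "A' $ i $ i = 0"
        using r by (simp add: diag w_def power_divide power2_eq_square flip: r(1))
      then show "{p. A' $ p $ p \<noteq> 0} \<noteq> {p. A $ p $ p \<noteq> 0}" using i by blast
    qed
    then have "card {p. A' $ p $ p \<noteq> 0} < card {p. A $ p $ p \<noteq> 0}"
      by (intro psubset_card_mono) simp_all
    from less.hyps[OF this sym' psd'] obtain ws where
      "\<forall>p q. A' $ p $ q = (\<Sum>w\<leftarrow>ws. w $ p * w $ q)" by blast
    then have "\<forall>p q. A $ p $ q = (\<Sum>w\<leftarrow>w # ws. w $ p * w $ q)"
      by (simp add: A'_def algebra_simps) 
    then show ?thesis by blast
  qed
qed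

text \<open>Written through a sum of squares of vectors \<open>w\<close>, the left-hand side is the sum of the
values of the form \<open>H\<close> at these vectors.\<close>

lemma trace_psd_nsd_nonpos:
  fixes A H :: "real^'n::finite^'n"
  assumes "transpose A = A" and "\<And>v. 0 \<le> v \<bullet> (A *v v)" and H: "\<And>v. v \<bullet> (H *v v) \<le> 0"
  shows "(\<Sum>i\<in>UNIV. \<Sum>j\<in>UNIV. A $ i $ j * H $ i $ j) \<le> 0"
proof -
  obtain ws where ws: "A $ i $ j = (\<Sum>w\<leftarrow>ws. w $ i * w $ j)" for i j
    using psd_sum_of_squares[OF assms(1,2)] by blast
  have "(\<Sum>i\<in>UNIV. \<Sum>j\<in>UNIV. (\<Sum>w\<leftarrow>ws. w $ i * w $ j) * H $ i $ j)
      = (\<Sum>w\<leftarrow>ws. w \<bullet> (H *v w))"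
    by (induction ws) (simp_all add: inner_matrix_vector algebra_simps sum.distrib)
  also have "\<dots> \<le> 0" using H by (intro sum_list_nonpos) auto
  finally show ?thesis by (simp add: ws)
qed

text \<open>Polarisation: diagonal entries are values of the form at unit vectors, the others are
obtained from its values at sums of two of them.\<close>

lemma close_entries:
  fixes A :: "real^'n::finite^'n"
  assumes sym: "transpose A = A" and \<epsilon>: "\<bar>\<epsilon>\<bar> \<le> 1/2"
    and lower: "\<And>v. inverse (1 + \<epsilon>) * (v \<bullet> v) \<le> v \<bullet> (A *v v)"
    and upper: "\<And>v. v \<bullet> (A *v v) \<le> (1 + \<epsilon>) * (v \<bullet> v)"
  shows "\<bar>(A - mat 1) $ i $ j\<bar> \<le> 4 * \<bar>\<epsilon>\<bar>"
proof -
  have inv: "1 - 2 * \<bar>\<epsilon>\<bar> \<le> inverse (1 + \<epsilon>)"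
  proof -
    have "(1 - 2 * \<bar>\<epsilon>\<bar>) * (1 + \<epsilon>) \<le> (1 - 2 * \<bar>\<epsilon>\<bar>) * (1 + \<bar>\<epsilon>\<bar>)"
      using \<epsilon> by (intro mult_left_mono) auto
    also have "\<dots> = 1 - \<bar>\<epsilon>\<bar> - 2 * (\<bar>\<epsilon>\<bar> * \<bar>\<epsilon>\<bar>)" by (simp add: algebra_simps)
    also have "\<dots> \<le> 1" by (smt (verit) mult_nonneg_nonneg)
    finally show ?thesis using \<epsilon> by (simp add: field_simps abs_le_iff)
  qed
  have Q: "\<bar>v \<bullet> (A *v v) - v \<bullet> v\<bar> \<le> 2 * \<bar>\<epsilon>\<bar> * (v \<bullet> v)" for v
  proof -
    have "(1 - 2 * \<bar>\<epsilon>\<bar>) * (v \<bullet> v) \<le> v \<bullet> (A *v v)"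
      using mult_right_mono[OF inv inner_ge_zero] lower order_trans by blast
    moreover have "v \<bullet> (A *v v) \<le> (1 + 2 * \<bar>\<epsilon>\<bar>) * (v \<bullet> v)"
      by (rule order_trans[OF upper mult_right_mono]) auto
    ultimately show ?thesis by (simp add: abs_le_iff algebra_simps)
  qed
  have diag: "\<bar>A $ k $ k - 1\<bar> \<le> 2 * \<bar>\<epsilon>\<bar>" for k
    using Q[of "axis k 1"] by (simp add: inner_axis_matrix_axis inner_axis_axis)
  show ?thesis
  proof (cases "i = j")
    case True
    then show ?thesis using diag[of i] by (simp add: mat_def)
  next
    case False
    have "A $ j $ i = transpose A $ i $ j" by (simp add: transpose_def)
    then have A: "A $ j $ i = A $ i $ j" by (simp add: sym)
    have "\<bar>A $ i $ i + A $ i $ j + (A $ i $ j + A $ j $ j) - 2\<bar> \<le> 2 * \<bar>\<epsilon>\<bar> * 2"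
      using Q[of "axis i 1 + axis j 1"] False A
      by (simp add: matrix_vector_right_distrib inner_add_left inner_add_right
          inner_axis_matrix_axis inner_axis_axis algebra_simps)
    then have "\<bar>A $ i $ j\<bar> \<le> 4 * \<bar>\<epsilon>\<bar>" using diag[of i] diag[of j] by linarith
    then show ?thesis using False by (simp add: mat_def)
  qed
qed

lemma matrix_inv_mult:
  fixes A :: "real^'n::finite^'n"
  assumes "invertible A"
  shows "A ** matrix_inv A = mat 1" "matrix_inv A ** A = mat 1"
proof -
  obtain B where "A ** B = mat 1 \<and> B ** A = mat 1" using assms by (auto simp: invertible_def)
  then have "A ** matrix_inv A = mat 1 \<and> matrix_inv A ** A = mat 1"
    unfolding matrix_inv_def by (rule someI)
  then show "A ** matrix_inv A = mat 1" "matrix_inv A ** A = mat 1" by auto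
qed

text \<open>The ellipticity of the inverse metric, with the same constants as the metric itself. Only
the values of the quadratic form enter, so that the bounds do not depend on the dimension.\<close>

lemma inverse_bounds:
  fixes A :: "real^'n::finite^'n"
  assumes sym: "transpose A = A"
    and lower: "\<And>v. (v \<bullet> v) / 2 \<le> v \<bullet> (A *v v)"
    and upper: "\<And>v. v \<bullet> (A *v v) \<le> 2 * (v \<bullet> v)"
  shows "invertible A"
    and "\<bar>matrix_inv A $ i $ j\<bar> \<le> 2"
    and "(w \<bullet> w) / 2 \<le> w \<bullet> (matrix_inv A *v w)"
    and "w \<bullet> (matrix_inv A *v w) \<le> 2 * (w \<bullet> w)"
proof -
  have "v = 0" if "A *v v = 0" for v
  proof -
    have "v \<bullet> v \<le> 0" using lower[of v] that by simp
    then show "v = 0" by (metis inner_gt_zero_iff not_le)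
  qed
  then show inv: "invertible A"
    by (simp add: invertible_left_inverse matrix_left_invertible_ker)
  have Aw: "A *v (matrix_inv A *v w) = w" for w
    by (simp add: matrix_vector_mul_assoc matrix_inv_mult(1)[OF inv])
  have norm: "norm (matrix_inv A *v w) \<le> 2 * norm w" for w
  proof -
    define v where "v = matrix_inv A *v w"
    have "norm v * norm v \<le> norm v * (2 * norm w)"
      using lower[of v] norm_cauchy_schwarz[of v w]
      by (simp add: v_def Aw dot_square_norm power2_eq_square)
    then show ?thesis unfolding v_def[symmetric]
      by (cases "v = 0") (simp_all add: mult_le_cancel_left)
  qed
  have "\<bar>matrix_inv A $ i $ j\<bar> = \<bar>(matrix_inv A *v axis j 1) $ i\<bar>"
    by (simp add: matrix_vector_mult_basis column_def)
  also have "\<dots> \<le> 2"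
    using component_le_norm_cart[of "matrix_inv A *v axis j 1" i] norm[of "axis j 1"] by simp
  finally show "\<bar>matrix_inv A $ i $ j\<bar> \<le> 2" .
  define v where "v = matrix_inv A *v w"
  have v: "A *v v = w" by (simp add: v_def Aw)
  have vw: "v \<bullet> (A *v w) = w \<bullet> w"
    using inner_matrix_commute[OF sym, of v w] by (simp add: v)
  \<comment> \<open>The lower bound on the inverse comes from the form of \<open>A\<close> at \<open>v - w / 2\<close>, with \<open>w = A v\<close>.\<close>
  have "((v - (1/2) *\<^sub>R w) \<bullet> (v - (1/2) *\<^sub>R w)) / 2 \<le> (v - (1/2) *\<^sub>R w) \<bullet> (A *v (v - (1/2) *\<^sub>R w))"
    by (rule lower)
  also have "\<dots> = w \<bullet> v - w \<bullet> w + (w \<bullet> (A *v w)) / 4"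
    by (simp add: matrix_vector_mult_diff_distrib matrix_vector_mult_scaleR inner_diff_left
        inner_diff_right v vw inner_commute[of v w] field_simps)
  finally have "0 \<le> w \<bullet> v - w \<bullet> w + (w \<bullet> (A *v w)) / 4"
    using inner_ge_zero[of "v - (1/2) *\<^sub>R w"] by linarith
  then show "(w \<bullet> w) / 2 \<le> w \<bullet> (matrix_inv A *v w)"
    using upper[of w] by (simp add: v_def)
  have "w \<bullet> v \<le> norm w * norm v" by (rule norm_cauchy_schwarz)
  also have "\<dots> \<le> norm w * (2 * norm w)"
    using norm[of w] by (intro mult_left_mono) (auto simp: v_def)
  finally show "w \<bullet> (matrix_inv A *v w) \<le> 2 * (w \<bullet> w)"
    by (simp add: v_def dot_square_norm power2_eq_square)
qed

lemma trace_bounds: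
  fixes A :: "real^'n::finite^'n"
  assumes "\<And>w. (w \<bullet> w) / 2 \<le> w \<bullet> (A *v w)" "\<And>w. w \<bullet> (A *v w) \<le> 2 * (w \<bullet> w)"
  shows "1 / 2 \<le> trace A" "trace A \<le> 2 * real CARD('n)"
proof -
  have "1 / 2 \<le> A $ i $ i" "A $ i $ i \<le> 2" for i
    using assms[of "axis i 1"] by (simp_all add: inner_axis_matrix_axis inner_axis_axis)
  then have "(\<Sum>i\<in>(UNIV::'n set). 1 / 2) \<le> trace A" "trace A \<le> (\<Sum>i\<in>(UNIV::'n set). 2)"
    unfolding trace_def by (intro sum_mono; simp)+
  moreover have "real CARD('n) \<ge> 1" by (simp add: Suc_le_eq)
  moreover have "(\<Sum>i\<in>(UNIV::'n set). 1 / 2) = real CARD('n) / 2" "(\<Sum>i\<in>(UNIV::'n set). 2)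
      = 2 * real CARD('n)"
    by simp_all
  ultimately show "1 / 2 \<le> trace A" "trace A \<le> 2 * real CARD('n)" by linarith+
qed

lemma norm_square_entries: "(norm A)\<^sup>2 = (\<Sum>i\<in>UNIV. \<Sum>j\<in>UNIV. (A $ i $ j)\<^sup>2)"
  for A :: "real^'n::finite^'n"
  unfolding power2_norm_eq_inner by (simp add: inner_vec_def power2_eq_square)

lemma norm_square_le_entries:
  fixes A :: "real^'n::finite^'n"
  assumes "\<And>i j. \<bar>A $ i $ j\<bar> \<le> c"
  shows "(norm A)\<^sup>2 \<le> (real CARD('n) * c)\<^sup>2"
proof -
  have "(A $ i $ j)\<^sup>2 \<le> c\<^sup>2" for i j
    using assms[of i j] by (metis abs_ge_zero power2_abs power_mono)
  then have "(norm A)\<^sup>2 \<le> (\<Sum>i\<in>(UNIV::'n set). \<Sum>j\<in>(UNIV::'n set). c\<^sup>2)"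
    unfolding norm_square_entries by (intro sum_mono)
  then show ?thesis by (simp add: power2_eq_square mult_ac)
qed

section \<open>Partial derivatives\<close>

text \<open>The analogue of \<open>partial\<close> for functions with values in a normed space, here matrices.\<close>

definition coord_deriv ::
  "'n::finite \<Rightarrow> (real^'n \<Rightarrow> 'b::real_normed_vector) \<Rightarrow> real^'n \<Rightarrow> 'b" where
  "coord_deriv i f x = frechet_derivative f (at x) (axis i 1)"

lemma partial_unique: "(f has_derivative f') (at x) \<Longrightarrow> partial i f x = f' (axis i 1)"
  unfolding partial_def using frechet_derivative_at by metis

lemma has_derivative_vec_nth: "(f has_derivative f') F \<Longrightarrow> ((\<lambda>x. f x $ i)
    has_derivative (\<lambda>h. f' h $ i)) F"
  by (rule bounded_linear.has_derivative[OF bounded_linear_vec_nth])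

lemma has_derivative_frechet:
  "f differentiable (at x) \<Longrightarrow> (f has_derivative frechet_derivative f (at x)) (at x)"
  by (simp add: frechet_derivative_works)

lemma partial_entry:
  assumes "f differentiable (at x)"
  shows "partial i (\<lambda>y. f y $ j $ l) x = coord_deriv i f x $ j $ l"
  using partial_unique[OF has_derivative_vec_nth[OF has_derivative_vec_nth[OF
      has_derivative_frechet[OF assms]]]]
  by (simp add: coord_deriv_def)

lemma differentiable_vec_nth: "f differentiable F \<Longrightarrow> (\<lambda>x. f x $ i) differentiable F"
  using has_derivative_vec_nth unfolding differentiable_def by blast

lemma partial_mult:
  assumes "f differentiable (at x)" "g differentiable (at x)"
  shows "partial i (\<lambda>y. f y * g y) x = partial i f x * g x + f x * partial i g x"
  using partial_unique[OF has_derivative_mult[OF assms[THEN has_derivative_frechet]]]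
  by (simp add: partial_def)

lemma partial_add:
  assumes "f differentiable (at x)" "g differentiable (at x)"
  shows "partial i (\<lambda>y. f y + g y) x = partial i f x + partial i g x"
  using partial_unique[OF has_derivative_add[OF assms[THEN has_derivative_frechet]]]
  by (simp add: partial_def)

lemma partial_diff:
  assumes "f differentiable (at x)" "g differentiable (at x)"
  shows "partial i (\<lambda>y. f y - g y) x = partial i f x - partial i g x"
  using partial_unique[OF has_derivative_diff[OF assms[THEN has_derivative_frechet]]]
  by (simp add: partial_def)

lemma partial_cmult:
  assumes "f differentiable (at x)"
  shows "partial i (\<lambda>y. c * f y) x = c * partial i f x"
  using partial_unique[OF has_derivative_mult_right[OF assms[THEN has_derivative_frechet]]]
  by (simp add: partial_def)

lemma partial_const: "partial i (\<lambda>y. c) x = 0"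
  by (simp add: partial_def)

lemma partial_sum:
  assumes "\<And>k. k \<in> S \<Longrightarrow> f k differentiable (at x)"
  shows "partial i (\<lambda>y. \<Sum>k\<in>S. f k y) x = (\<Sum>k\<in>S. partial i (f k) x)"
  using partial_unique[OF has_derivative_sum[OF assms[THEN has_derivative_frechet]]]
  by (simp add: partial_def)

lemma differentiable_prod:
  fixes f :: "'i \<Rightarrow> 'a::real_normed_vector \<Rightarrow> real"
  assumes "finite S" "\<And>k. k \<in> S \<Longrightarrow> f k differentiable (at x)"
  shows "(\<lambda>y. \<Prod>k\<in>S. f k y) differentiable (at x)"
  using assms by (induction S rule: finite_induct) (auto intro: differentiable_mult)

lemma differentiable_det:
  fixes M :: "'a::real_normed_vector \<Rightarrow> real^'n::finite^'n"
  assumes "\<And>i j. (\<lambda>y. M y $ i $ j) differentiable (at x)"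
  shows "(\<lambda>y. det (M y)) differentiable (at x)"
  unfolding det_def
  by (intro differentiable_sum ballI differentiable_mult differentiable_prod differentiable_const
      assms finite finite_permutations)

lemma matrix_inv_cramer:
  fixes A :: "real^'n::finite^'n"
  assumes "invertible A"
  shows "matrix_inv A $ k $ l
    = det (\<chi> i j. if j = k then axis l 1 $ i else A $ i $ j) / det A"
proof -
  have "det A \<noteq> 0" using assms by (simp add: invertible_det_nz)
  moreover have "A *v (matrix_inv A *v axis l 1) = axis l 1"
    by (simp add: matrix_vector_mul_assoc matrix_inv_mult[OF assms])
  ultimately have "matrix_inv A *v axis l 1
      = (\<chi> k. det (\<chi> i j. if j = k then axis l 1 $ i else A $ i $ j) / det A)"
    using cramer[of A "matrix_inv A *v axis l 1" "axis l 1"] by blast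
  then have "(matrix_inv A *v axis l 1) $ k
      = det (\<chi> i j. if j = k then axis l 1 $ i else A $ i $ j) / det A" by simp
  then show ?thesis by (simp add: matrix_vector_mult_basis column_def)
qed

text \<open>By Cramer's rule the entries of the inverse are quotients of polynomials in the entries.\<close>

lemma differentiable_matrix_inv:
  fixes G :: "'a::real_normed_vector \<Rightarrow> real^'n::finite^'n"
  assumes "G differentiable (at x)" and inv: "\<And>y. invertible (G y)"
  shows "(\<lambda>y. matrix_inv (G y) $ k $ l) differentiable (at x)"
  unfolding matrix_inv_cramer[OF inv]
proof (intro differentiable_divide differentiable_det)
  have G: "(\<lambda>y. G y $ i $ j) differentiable (at x)" for i j
    by (intro differentiable_vec_nth assms)
  show "(\<lambda>y. G y $ i $ j) differentiable (at x)" for i j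
    by (rule G)
  show "(\<lambda>y. (\<chi> i j. if j = k then axis l 1 $ i else G y $ i $ j) $ i $ j) differentiable (at x)"
    for i j
    unfolding vec_lambda_beta using G[of i j] by (cases "j = k") auto
  show "det (G x) \<noteq> 0" using inv by (simp add: invertible_det_nz)
qed

lemma has_derivative_partials:
  fixes f :: "real^'n::finite \<Rightarrow> real"
  assumes "f differentiable (at x)"
  shows "(f has_derivative (\<lambda>v. (\<chi> i. partial i f x) \<bullet> v)) (at x)"
proof -
  have "frechet_derivative f (at x) v = (\<chi> i. partial i f x) \<bullet> v" for v
  proof -
    have "frechet_derivative f (at x) v = frechet_derivative f (at x) (\<Sum>i\<in>UNIV. v $ i *\<^sub>R axis i 1)"
      using basis_expansion[of v] by (simp add: scalar_mult_eq_scaleR)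
    also have "\<dots> = (\<Sum>i\<in>UNIV. v $ i * partial i f x)"
      by (simp add: linear_sum[OF linear_frechet_derivative[OF assms]]
          linear_scale[OF linear_frechet_derivative[OF assms]] partial_def)
    finally show ?thesis by (simp add: inner_vec_def mult.commute)
  qed
  then have "frechet_derivative f (at x) = (\<lambda>v. (\<chi> i. partial i f x) \<bullet> v)" by (rule ext)
  then show ?thesis using has_derivative_frechet[OF assms] by metis
qed

lemma has_derivative_gradient:
  fixes f :: "real^'n::finite \<Rightarrow> real"
  assumes "\<And>i. partial i f differentiable (at x)"
  shows "((\<lambda>y. \<chi> i. partial i f y) has_derivative (\<lambda>v. (\<chi> i j. partial j (partial i f) x) *v v))
      (at x)"
proof -
  have "((\<lambda>y. (\<chi> i. partial i f y) \<bullet> b) has_derivative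
      (\<lambda>v. ((\<chi> i j. partial j (partial i f) x) *v v) \<bullet> b)) (at x)" if Basis: "b \<in> Basis" for b
  proof -
    obtain i where b: "b = axis i 1" using Basis unfolding Basis_vec_def Basis_real_def by blast
    have "((\<chi> i j. partial j (partial i f) x) *v v) $ i = (\<chi> j. partial j (partial i f) x) \<bullet> v" for v
      by (simp add: matrix_vector_mult_def inner_vec_def)
    then show ?thesis
      using has_derivative_partials[OF assms[of i]] by (simp add: b inner_axis)
  qed
  then show ?thesis
    using has_derivative_componentwise_within[where S=UNIV] by blast
qed

lemma has_derivative_along_line:
  assumes "f differentiable (at (y + s *\<^sub>R u))"
  shows "((\<lambda>s. f (y + s *\<^sub>R u)) has_vector_derivative
      frechet_derivative f (at (y + s *\<^sub>R u)) u) (at s)"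
proof -
  have "((\<lambda>s. y + s *\<^sub>R u) has_derivative (\<lambda>h. h *\<^sub>R u)) (at s)"
    by (auto intro!: derivative_eq_intros)
  from has_derivative_compose[OF this has_derivative_frechet[OF assms]]
  show ?thesis
    unfolding has_vector_derivative_def
    by (simp add: linear_scale[OF linear_frechet_derivative[OF assms]])
qed

lemma has_real_derivative_along_line:
  fixes f :: "'a::real_normed_vector \<Rightarrow> real"
  assumes "f differentiable (at (y + s *\<^sub>R u))"
  shows "((\<lambda>s. f (y + s *\<^sub>R u)) has_real_derivative
      frechet_derivative f (at (y + s *\<^sub>R u)) u) (at s)"
  using has_derivative_along_line[OF assms]
  by (simp add: has_real_derivative_iff_has_vector_derivative)

text \<open>Two applications of the mean value theorem. The left-hand side of the equation is
symmetric in \<open>u\<close> and \<open>v\<close>, which is the source of the symmetry of second derivatives.\<close>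

lemma second_difference_mean_value:
  fixes f :: "'a::real_normed_vector \<Rightarrow> real"
  defines "fu \<equiv> \<lambda>y u. frechet_derivative f (at y) u"
  assumes f: "\<And>y. f differentiable (at y)" and fu: "\<And>y. (\<lambda>y. fu y u) differentiable (at y)"
    and s: "s > 0"
  shows "\<exists>p. norm (p - x) \<le> s * (norm u + norm v) \<and>
    f (x + s *\<^sub>R u + s *\<^sub>R v) - f (x + s *\<^sub>R u) - f (x + s *\<^sub>R v) + f x
      = s\<^sup>2 * frechet_derivative (\<lambda>y. fu y u) (at p) v"
proof -
  \<comment> \<open>The second difference of \<open>f\<close> is the first difference of this function.\<close>
  define \<phi> where "\<phi> r = f ((x + s *\<^sub>R v) + r *\<^sub>R u) - f (x + r *\<^sub>R u)" for r
  have "(\<phi> has_real_derivative fu ((x + s *\<^sub>R v) + r *\<^sub>R u) u - fu (x + r *\<^sub>R u) u) (at r)" for r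
    unfolding \<phi>_def[abs_def] fu_def
    by (intro DERIV_diff has_real_derivative_along_line f)
  from MVT2[OF s this] obtain \<xi> where \<xi>: "0 < \<xi>" "\<xi> < s"
    "\<phi> s - \<phi> 0 = s * (fu ((x + s *\<^sub>R v) + \<xi> *\<^sub>R u) u - fu (x + \<xi> *\<^sub>R u) u)" by auto
  have "((\<lambda>r. fu ((x + \<xi> *\<^sub>R u) + r *\<^sub>R v) u) has_real_derivative
      frechet_derivative (\<lambda>y. fu y u) (at ((x + \<xi> *\<^sub>R u) + r *\<^sub>R v)) v) (at r)" for r
    by (intro has_real_derivative_along_line fu)
  from MVT2[OF s this] obtain \<eta> where \<eta>: "0 < \<eta>" "\<eta> < s"
    "fu ((x + \<xi> *\<^sub>R u) + s *\<^sub>R v) u - fu (x + \<xi> *\<^sub>R u) u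
      = s * frechet_derivative (\<lambda>y. fu y u) (at ((x + \<xi> *\<^sub>R u) + \<eta> *\<^sub>R v)) v" by auto
  define p where "p = (x + \<xi> *\<^sub>R u) + \<eta> *\<^sub>R v"
  have "norm (p - x) \<le> norm (\<xi> *\<^sub>R u) + norm (\<eta> *\<^sub>R v)"
    unfolding p_def by (metis add.assoc add_diff_cancel_left' norm_triangle_ineq)
  also have "\<dots> \<le> s * norm u + s * norm v"
    using \<xi> \<eta> by (auto intro!: add_mono mult_right_mono)
  finally have p: "norm (p - x) \<le> s * (norm u + norm v)" by (simp add: algebra_simps)
  have "f (x + s *\<^sub>R u + s *\<^sub>R v) - f (x + s *\<^sub>R u) - f (x + s *\<^sub>R v) + f x = \<phi> s - \<phi> 0"
    by (simp add: \<phi>_def algebra_simps)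
  also have "\<dots> = s * (fu ((x + \<xi> *\<^sub>R u) + s *\<^sub>R v) u - fu (x + \<xi> *\<^sub>R u) u)"
    unfolding \<xi>(3) by (simp add: algebra_simps)
  also have "\<dots> = s\<^sup>2 * frechet_derivative (\<lambda>y. fu y u) (at p) v"
    unfolding \<eta>(3) p_def by (simp add: power2_eq_square)
  finally show ?thesis using p by blast
qed

text \<open>Both mixed derivatives, at points close to \<open>x\<close>, equal the same difference quotient.\<close>

lemma frechet_derivative_commute:
  fixes f :: "'a::real_normed_vector \<Rightarrow> real"
  defines "fu \<equiv> \<lambda>y u. frechet_derivative f (at y) u"
  assumes f: "\<And>y. f differentiable (at y)" and fu: "\<And>w y. w \<in> {u, v}
      \<Longrightarrow> (\<lambda>y. fu y w) differentiable (at y)"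
    and cont: "isCont (\<lambda>y. frechet_derivative (\<lambda>y. fu y u) (at y) v) x"
      "isCont (\<lambda>y. frechet_derivative (\<lambda>y. fu y v) (at y) u) x"
  shows "frechet_derivative (\<lambda>y. fu y u) (at x) v = frechet_derivative (\<lambda>y. fu y v) (at x) u"
proof (rule ccontr)
  define a where "a y = frechet_derivative (\<lambda>y. fu y u) (at y) v" for y
  define b where "b y = frechet_derivative (\<lambda>y. fu y v) (at y) u" for y
  assume "\<not> ?thesis"
  then have "\<bar>a x - b x\<bar> / 2 > 0" by (simp add: a_def b_def)
  with cont obtain d1 d2 where
    d1: "d1 > 0" "\<And>y. norm (y - x) < d1 \<Longrightarrow> \<bar>a y - a x\<bar> < \<bar>a x - b x\<bar> / 2" and
    d2: "d2 > 0" "\<And>y. norm (y - x) < d2 \<Longrightarrow> \<bar>b y - b x\<bar> < \<bar>a x - b x\<bar> / 2"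
    unfolding a_def[symmetric] b_def[symmetric] continuous_at_eps_delta dist_norm real_norm_def
    by metis
  \<comment> \<open>So small that the points provided by the mean value theorem lie within both radii of continuity.\<close>
  define s where "s = min d1 d2 / (2 * (norm u + norm v + 1))"
  have nn: "norm u + norm v + 1 > 0" by (smt (verit) norm_ge_zero)
  have s: "s > 0" using d1 d2 nn by (simp add: s_def)
  have "s * (norm u + norm v) \<le> s * (norm u + norm v + 1)" using s by simp
  also have "\<dots> = min d1 d2 / 2" using nn by (simp add: s_def field_simps)
  also have "\<dots> < min d1 d2" using d1(1) d2(1) by linarith
  finally have small: "s * (norm u + norm v) < d1" "s * (norm u + norm v) < d2" by auto
  obtain p where p: "norm (p - x) \<le> s * (norm u + norm v)"
    "f (x + s *\<^sub>R u + s *\<^sub>R v) - f (x + s *\<^sub>R u) - f (x + s *\<^sub>R v) + f x = s\<^sup>2 * a p"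
    using second_difference_mean_value[of f u s x v] f fu s unfolding fu_def a_def by blast
  obtain q where q: "norm (q - x) \<le> s * (norm v + norm u)"
    "f (x + s *\<^sub>R v + s *\<^sub>R u) - f (x + s *\<^sub>R v) - f (x + s *\<^sub>R u) + f x = s\<^sup>2 * b q"
    using second_difference_mean_value[of f v s x u] f fu s unfolding fu_def b_def by blast
  have swap: "x + s *\<^sub>R v + s *\<^sub>R u = x + s *\<^sub>R u + s *\<^sub>R v" by (simp add: algebra_simps)
  have "s\<^sup>2 * a p = s\<^sup>2 * b q" using p(2) q(2)[unfolded swap] by linarith
  then have "a p = b q" using s by simp
  moreover have "\<bar>a p - a x\<bar> < \<bar>a x - b x\<bar> / 2"
    using d1(2)[of p] p(1) small by linarith
  moreover have "\<bar>b q - b x\<bar> < \<bar>a x - b x\<bar> / 2"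
    using d2(2)[of q] q(1) small by (simp add: add.commute)
  moreover have "\<bar>a x - b x\<bar> \<le> \<bar>b q - b x\<bar> + \<bar>a p - a x\<bar>"
    using abs_triangle_ineq4[of "b q - b x" "a p - a x"] \<open>a p = b q\<close> by simp
  moreover have False if "p < r / 2" "q < r / 2" "r \<le> q + p" for p q r :: real
    using that by linarith
  ultimately show False by blast
qed

lemma coord_deriv_commute:
  fixes G :: "'n::finite tensor_field"
  assumes G: "\<And>y. G differentiable (at y)" and DG: "\<And>i y. coord_deriv i G differentiable (at y)"
    and HG: "\<And>i j y. coord_deriv i (coord_deriv j G) differentiable (at y)"
  shows "coord_deriv i (coord_deriv j G) x = coord_deriv j (coord_deriv i G) x"
proof -
  have fu: "frechet_derivative (\<lambda>y. G y $ a $ b) (at y) (axis k 1) = coord_deriv k G y $ a $ b"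
      for k a b y
    using partial_entry[OF G[of y], of k a b] by (simp add: partial_def)
  have H: "frechet_derivative (\<lambda>y. coord_deriv k G y $ a $ b) (at y) (axis l 1)
      = coord_deriv l (coord_deriv k G) y $ a $ b" for k l a b y
    using partial_entry[OF DG[of k y], of l a b] by (simp add: partial_def)
  have "coord_deriv i (coord_deriv j G) x $ a $ b = coord_deriv j (coord_deriv i G) x $ a $ b" for a b
  proof -
    have cont: "isCont (\<lambda>y. coord_deriv i (coord_deriv j G) y $ a $ b) x" for i j
      by (intro differentiable_imp_continuous_within differentiable_vec_nth HG)
    have diff: "(\<lambda>y. coord_deriv k G y $ a $ b) differentiable (at y)" for k y
      by (intro differentiable_vec_nth DG)
    have fdiff: "(\<lambda>y. frechet_derivative (\<lambda>y. G y $ a $ b) (at y) w) differentiable (at y)"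
      if "w \<in> {axis j 1, axis i 1}" for w y
      using that diff by (auto simp: fu)
    show ?thesis
      using frechet_derivative_commute[of "\<lambda>y. G y $ a $ b" "axis j 1" "axis i 1" x, unfolded fu H,
          OF differentiable_vec_nth[OF differentiable_vec_nth[OF G]] _ cont cont] fdiff
      by blast
  qed
  then show ?thesis by (simp add: vec_eq_iff)
qed

section \<open>Smooth families and interpolation\<close>

lemma coord_deriv_eq_iter_deriv: "coord_deriv i (iter_deriv UNIV vs f)
    = iter_deriv UNIV (axis i 1 # vs) f"
  by (rule ext) (simp add: coord_deriv_def)

lemma axis_mem_Basis: "axis i (1::real) \<in> Basis"
  by (simp add: axis_in_Basis_iff)

text \<open>The function spaces speak of derivatives on space-time, the flow and the conclusion of
derivatives on time slices. The former in the directions \<open>(v, 0)\<close> are the latter in the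
directions \<open>v\<close>, by the chain rule for the inclusion of a slice.\<close>

lemma iter_deriv_slice:
  fixes F :: "'a::euclidean_space \<times> real \<Rightarrow> 'b::real_normed_vector"
  assumes F: "Ck_on \<infinity> (UNIV \<times> {0<..}) F" and "set vs \<subseteq> Basis" and "t > 0"
  shows "iter_deriv UNIV vs (\<lambda>x. F (x, t)) x
      = iter_deriv (UNIV \<times> {0<..}) (map (\<lambda>v. (v, 0)) vs) F (x, t)"
    and "iter_deriv UNIV vs (\<lambda>x. F (x, t)) differentiable (at x)"
proof -
  define S where "S = (UNIV :: 'a set) \<times> {0::real<..}"
  have S: "open S" unfolding S_def by (intro open_Times) auto
  have dF: "iter_deriv S (map (\<lambda>v. (v, 0)) vs) F differentiable_on S" if "set vs \<subseteq> Basis" for vs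
  proof -
    have "set (map (\<lambda>v. (v, 0::real)) vs) \<subseteq> Basis"
      using that by (auto simp: Basis_prod_def)
    then show ?thesis using F unfolding Ck_on_def Ck_loc_on_def S_def by auto
  qed
  have step: "((\<lambda>x. iter_deriv S (map (\<lambda>v. (v, 0)) vs) F (x, t)) has_derivative
      (\<lambda>h. frechet_derivative (iter_deriv S (map (\<lambda>v. (v, 0)) vs) F) (at (x, t)) (h, 0))) (at x)"
    if "set vs \<subseteq> Basis" for vs x
  proof -
    have "((\<lambda>x. (x, t)) has_derivative (\<lambda>h. (h, 0))) (at x)"
      by (auto intro!: derivative_eq_intros)
    moreover have "(x, t) \<in> S" using \<open>t > 0\<close> by (simp add: S_def)
    then have "iter_deriv S (map (\<lambda>v. (v, 0)) vs) F differentiable (at (x, t))"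
      using dF[OF that] S by (metis at_within_open differentiable_on_def)
    ultimately show ?thesis
      using has_derivative_compose has_derivative_frechet by blast
  qed
  have eq: "iter_deriv UNIV vs (\<lambda>x. F (x, t)) = (\<lambda>x. iter_deriv S (map (\<lambda>v. (v, 0)) vs) F (x, t))"
    if "set vs \<subseteq> Basis" for vs
    using that
  proof (induction vs)
    case (Cons v vs)
    have "frechet_derivative (\<lambda>x. iter_deriv S (map (\<lambda>v. (v, 0)) vs) F (x, t)) (at x) v
        = frechet_derivative (iter_deriv S (map (\<lambda>v. (v, 0)) vs) F) (at (x, t) within S) (v, 0)" for x
    proof -
      have "at (x, t) within S = at (x, t)"
        using S \<open>t > 0\<close> by (intro at_within_open) (auto simp: S_def)
      then show ?thesis
        using frechet_derivative_at[OF step[of vs x], symmetric] Cons.prems by simp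
    qed
    moreover have "iter_deriv UNIV vs (\<lambda>x. F (x, t)) = (\<lambda>x. iter_deriv S (map (\<lambda>v. (v, 0)) vs) F
        (x, t))"
      using Cons by simp
    ultimately show ?case by simp
  qed simp
  show "iter_deriv UNIV vs (\<lambda>x. F (x, t)) x
      = iter_deriv (UNIV \<times> {0<..}) (map (\<lambda>v. (v, 0)) vs) F (x, t)"
    using eq[OF assms(2)] by (simp add: S_def fun_eq_iff)
  show "iter_deriv UNIV vs (\<lambda>x. F (x, t)) differentiable (at x)"
    unfolding eq[OF assms(2)] using step[OF assms(2)] by (auto simp: differentiable_def)
qed

lemma iter_deriv_bounded:
  fixes F :: "'a::euclidean_space \<times> real \<Rightarrow> 'b::real_normed_vector"
  assumes F: "Ck_on \<infinity> (UNIV \<times> {0<..}) F" and vs: "set vs \<subseteq> Basis"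
  shows "\<exists>M. \<forall>t>0. \<forall>x. norm (iter_deriv UNIV vs (\<lambda>x. F (x, t)) x) \<le> M"
proof -
  have "set (map (\<lambda>v. (v, 0::real)) vs) \<subseteq> Basis"
    using vs by (auto simp: Basis_prod_def)
  then have "bounded (iter_deriv (UNIV \<times> {0<..}) (map (\<lambda>v. (v, 0)) vs) F ` (UNIV \<times> {0<..}))"
    using F unfolding Ck_on_def by auto
  then obtain M where "\<And>p. p \<in> UNIV \<times> {0<..} \<Longrightarrow>
      norm (iter_deriv (UNIV \<times> {0<..}) (map (\<lambda>v. (v, 0)) vs) F p) \<le> M"
    unfolding bounded_iff by blast
  then show ?thesis
    by (intro exI[of _ M]) (simp add: iter_deriv_slice(1)[OF F vs])
qed

text \<open>A Landau--Kolmogorov type inequality: the difference of two values of \<open>f\<close> at distance \<open>s\<close>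
is small, and it differs from \<open>s f'\<close> by at most \<open>M s\<^sup>2\<close>. The constant \<open>c\<close> drops out of the
difference.\<close>

lemma directional_derivative_interpolation:
  fixes f :: "'a::real_normed_vector \<Rightarrow> 'b::real_inner"
  assumes f: "\<And>y. f differentiable (at y)"
    and f': "\<And>y. (\<lambda>y. frechet_derivative f (at y) v) differentiable (at y)"
    and M: "\<And>y. norm (frechet_derivative (\<lambda>y. frechet_derivative f (at y) v) (at y) v) \<le> M"
    and \<eta>: "\<And>y. norm (f y - c) \<le> \<eta>" and s: "s > 0"
  shows "norm (frechet_derivative f (at x) v) \<le> 2 * \<eta> / s + M * s"
proof -
  define F where "F y = frechet_derivative f (at y) v" for y
  have "0 \<le> M" using M[of x] norm_ge_zero order_trans by blast
  have F: "norm (F (x + r *\<^sub>R v) - F x) \<le> M * r" if "r > 0" for r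
  proof -
    have d: "((\<lambda>r. F (x + r *\<^sub>R v)) has_derivative
        (\<lambda>h. h *\<^sub>R frechet_derivative F (at (x + r *\<^sub>R v)) v)) (at r)" for r
      using has_derivative_along_line[of F x r v] f'
      by (simp add: F_def[abs_def] has_vector_derivative_def)
    have "continuous_on {0..r} (\<lambda>r. F (x + r *\<^sub>R v))"
      by (intro differentiable_imp_continuous_on)
        (use d in \<open>auto simp: differentiable_on_def differentiable_def intro:
            has_derivative_at_withinI\<close>)
    from mvt_general[OF that this d] obtain z where
      "norm (F (x + r *\<^sub>R v) - F x) \<le> norm (r *\<^sub>R frechet_derivative F (at (x + z *\<^sub>R v)) v)" by auto
    also have "\<dots> \<le> r * M"
      using that M by (simp add: F_def[abs_def])
    finally show ?thesis by (simp add: mult.commute)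
  qed
  \<comment> \<open>Remainder of the first-order expansion of \<open>f\<close> along \<open>v\<close>; its derivative is at most \<open>M s\<close>.\<close>
  define \<psi> where "\<psi> r = f (x + r *\<^sub>R v) - r *\<^sub>R F x" for r
  have d: "(\<psi> has_derivative (\<lambda>h. h *\<^sub>R (F (x + r *\<^sub>R v) - F x))) (at r)" for r
  proof -
    have "((\<lambda>r. f (x + r *\<^sub>R v)) has_derivative (\<lambda>h. h *\<^sub>R F (x + r *\<^sub>R v))) (at r)"
      using has_derivative_along_line[of f x r v] f
      by (simp add: F_def[abs_def] has_vector_derivative_def)
    then show ?thesis unfolding \<psi>_def[abs_def]
      by (auto intro!: derivative_eq_intros simp: algebra_simps)
  qed
  have "continuous_on {0..s} \<psi>"
    by (intro differentiable_imp_continuous_on)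
      (use d in \<open>auto simp: differentiable_on_def differentiable_def intro:
          has_derivative_at_withinI\<close>)
  from mvt_general[OF s this d] obtain z where z: "0 < z" "z < s"
    "norm (\<psi> s - \<psi> 0) \<le> norm (s *\<^sub>R (F (x + z *\<^sub>R v) - F x))" by auto
  have "norm (s *\<^sub>R (F (x + z *\<^sub>R v) - F x)) \<le> s * (M * z)"
    using F[of z] z s by simp
  also have "\<dots> \<le> s * (M * s)" using s z \<open>0 \<le> M\<close> by (intro mult_left_mono) auto
  finally have 1: "norm (\<psi> s - \<psi> 0) \<le> s * (M * s)" using z by linarith
  have "s * norm (F x) = norm ((f (x + s *\<^sub>R v) - c) - (f x - c) - (\<psi> s - \<psi> 0))"
    using s by (simp add: \<psi>_def)
  also have "\<dots> \<le> \<eta> + \<eta> + s * (M * s)"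
    using norm_triangle_ineq4[of "(f (x + s *\<^sub>R v) - c) - (f x - c)" "\<psi> s - \<psi> 0"]
      norm_triangle_ineq4[of "f (x + s *\<^sub>R v) - c" "f x - c"] \<eta>[of x] \<eta>[of "x + s *\<^sub>R v"] 1
          by linarith
  finally show ?thesis using s by (simp add: F_def field_simps)
qed

text \<open>Each derivative is interpolated between the previous one, which converges uniformly, and
the next one, which is bounded.\<close>

lemma derivatives_tendsto_zero:
  fixes F :: "'a::euclidean_space \<times> real \<Rightarrow> 'b::real_inner"
  assumes F: "Ck_on \<infinity> (UNIV \<times> {0<..}) F"
    and lim: "uniform_limit UNIV (\<lambda>t x. F (x, t)) (\<lambda>_. c) at_top"
    and "set vs \<subseteq> Basis" "vs \<noteq> []"
  shows "uniform_limit UNIV (\<lambda>t. iter_deriv UNIV vs (\<lambda>x. F (x, t))) (\<lambda>_. 0) at_top"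
proof -
  have step: "uniform_limit UNIV (\<lambda>t. iter_deriv UNIV (v # vs) (\<lambda>x. F (x, t))) (\<lambda>_. 0) at_top"
    if vs: "set vs \<subseteq> Basis" "v \<in> Basis"
      and lim: "uniform_limit UNIV (\<lambda>t. iter_deriv UNIV vs (\<lambda>x. F (x, t))) (\<lambda>_. c) at_top" for v vs c
  proof (rule uniform_limitI)
    fix e :: real assume e: "e > 0"
    obtain M0 where M0: "\<And>t x. t > 0 \<Longrightarrow> norm (iter_deriv UNIV (v # v # vs) (\<lambda>x. F (x, t)) x) \<le> M0"
      using iter_deriv_bounded[OF F, of "v # v # vs"] vs by auto
    define M where "M = \<bar>M0\<bar> + 1"
    have M: "norm (iter_deriv UNIV (v # v # vs) (\<lambda>x. F (x, t)) x) \<le> M" if "t > 0" for t x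
      using M0[OF that, of x] by (simp add: M_def)
    have "M > 0" by (simp add: M_def)
    \<comment> \<open>The step balances the second-derivative term to \<open>e / 4\<close>; the other one then needs \<open>\<eta>
        = e s / 8\<close>.\<close>
    define s where "s = e / (4 * M)"
    have s: "s > 0" "M * s = e / 4" using e \<open>M > 0\<close> by (auto simp: s_def)
    have "e * s / 8 > 0" using e s by simp
    from uniform_limitD[OF lim this]
    show "\<forall>\<^sub>F t in at_top. \<forall>x\<in>UNIV. dist (iter_deriv UNIV (v # vs) (\<lambda>x. F (x, t)) x) 0 < e"
      using eventually_gt_at_top[of 0]
    proof eventually_elim
      case (elim t)
      have "norm (frechet_derivative (iter_deriv UNIV vs (\<lambda>x. F (x, t))) (at x) v)
          \<le> 2 * (e * s / 8) / s + M * s" for x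
      proof (rule directional_derivative_interpolation[where c = c])
        show "iter_deriv UNIV vs (\<lambda>x. F (x, t)) differentiable (at y)" for y
          using iter_deriv_slice(2)[OF F vs(1)] elim by simp
        show "(\<lambda>y. frechet_derivative (iter_deriv UNIV vs (\<lambda>x. F (x, t))) (at y) v) differentiable
            (at y)" for y
          using iter_deriv_slice(2)[OF F, of "v # vs"] vs elim by simp
        show "norm (frechet_derivative (\<lambda>y. frechet_derivative (iter_deriv UNIV vs (\<lambda>x. F (x, t)))
            (at y) v) (at y) v) \<le> M" for y
          using M[of t y] elim by simp
        show "norm (iter_deriv UNIV vs (\<lambda>x. F (x, t)) y - c) \<le> e * s / 8" for y
          using elim(1) by (auto simp: dist_norm less_imp_le)
      qed (rule s)
      also have "\<dots> < e" using s e by simp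
      finally show ?case by simp
    qed
  qed
  \<comment> \<open>Only the function itself tends to \<open>c\<close>; from the first derivative on the limit is \<open>0\<close>.\<close>
  from assms(3,4) show ?thesis
  proof (induction vs)
    case (Cons v vs)
    show ?case
    proof (cases "vs = []")
      case True
      then show ?thesis using step[of "[]" v c] lim Cons.prems by simp
    next
      case False
      then show ?thesis using step[of vs v 0] Cons by simp
    qed
  qed simp
qed

section \<open>The parabolic maximum principle\<close>

definition twice_differentiable :: "(real^'n::finite \<Rightarrow> real) \<Rightarrow> bool" where
  "twice_differentiable f \<longleftrightarrow>
    (\<forall>y. f differentiable (at y)) \<and> (\<forall>i y. partial i f differentiable (at y))"

definition elliptic_op :: "real^'n^'n \<Rightarrow> (real^'n::finite \<Rightarrow> real) \<Rightarrow> real^'n \<Rightarrow> real" where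
  "elliptic_op A f x = (\<Sum>i\<in>UNIV. \<Sum>j\<in>UNIV. A $ i $ j * partial j (partial i f) x)"

text \<open>The restriction of \<open>f\<close> to a line has a critical point at the maximum; a positive second
derivative would make it increase afterwards.\<close>

lemma second_derivative_test:
  fixes f :: "'a::real_inner \<Rightarrow> real"
  assumes f: "\<And>y. (f has_derivative (\<lambda>v. P y \<bullet> v)) (at y)"
    and P: "(P has_derivative D) (at x)"
    and d: "0 < d" "\<And>y. dist x y < d \<Longrightarrow> f y \<le> f x"
  shows "D w \<bullet> w \<le> 0"
proof (rule ccontr)
  assume "\<not> ?thesis"
  then have pos: "D w \<bullet> w > 0" by simp
  then have "w \<noteq> 0" by auto
  define q where "q s = f (x + s *\<^sub>R w)" for s
  define q' where "q' s = P (x + s *\<^sub>R w) \<bullet> w" for s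
  have q: "(q has_real_derivative q' s) (at s)" for s
  proof -
    have "((\<lambda>s. x + s *\<^sub>R w) has_derivative (\<lambda>h. h *\<^sub>R w)) (at s)"
      by (auto intro!: derivative_eq_intros)
    from has_derivative_compose[OF this f]
    show ?thesis
      unfolding q_def[abs_def] q'_def by (rule has_derivative_imp_has_field_derivative) simp
  qed
  have q': "(q' has_real_derivative D w \<bullet> w) (at 0)"
  proof -
    have "((\<lambda>s. x + s *\<^sub>R w) has_derivative (\<lambda>h. h *\<^sub>R w)) (at 0)"
      by (auto intro!: derivative_eq_intros)
    from has_derivative_compose[OF this, of P D] P
    have "((\<lambda>s. P (x + s *\<^sub>R w)) has_derivative (\<lambda>h. D (h *\<^sub>R w))) (at 0)" by simp
    from has_derivative_inner_left[OF this, of w]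
    show ?thesis
      unfolding q'_def[abs_def]
      by (rule has_derivative_imp_has_field_derivative)
        (simp add: linear_scale[OF has_derivative_linear[OF P]])
  qed
  have small: "q s \<le> q 0" if "\<bar>s\<bar> < d / norm w" for s
  proof -
    have "dist x (x + s *\<^sub>R w) < d"
      using that \<open>w \<noteq> 0\<close> by (simp add: dist_norm field_simps)
    from d(2)[OF this] show ?thesis by (simp add: q_def)
  qed
  have dw: "d / norm w > 0" using d(1) \<open>w \<noteq> 0\<close> by simp
  have q'0: "q' 0 = 0"
    by (rule DERIV_local_max[OF q dw]) (use small in auto)
  obtain e where e: "e > 0" "\<And>h. 0 < h \<Longrightarrow> h < e \<Longrightarrow> q' 0 < q' (0 + h)"
    using DERIV_pos_inc_right[OF q' pos] by blast
  obtain s where s: "0 < s" "s < e" "s < d / norm w"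
    using field_lbound_gt_zero[OF e(1) dw] by blast
  obtain z where z: "0 < z" "z < s" "q s - q 0 = (s - 0) * q' z"
    using MVT2[OF s(1), of q q'] q by blast
  have "q' z > 0" using e(2)[of z] z s q'0 by simp
  then have "s * q' z > 0" using s by simp
  then have "q s > q 0" using z(3) by simp
  then show False using small[of s] s by simp
qed

text \<open>At a positive maximum over a space-time cylinder the time derivative is nonnegative and
the Hessian is negative semidefinite, which the strict inequality excludes. The condition for
large \<open>norm x\<close> confines a positive maximum to the interior of the cylinder and takes the place
of a boundary condition.\<close>

lemma parabolic_maximum_principle:
  fixes \<phi> :: "real^'n::finite \<Rightarrow> real \<Rightarrow> real" and a :: "real^'n \<Rightarrow> real \<Rightarrow> real^'n^'n"
  assumes cont: "continuous_on (UNIV \<times> {0..}) (\<lambda>(x, t). \<phi> x t)"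
    and dt: "\<And>x t. t > 0 \<Longrightarrow> ((\<lambda>s. \<phi> x s) has_real_derivative \<phi>t x t) (at t)"
    and tw: "\<And>t. t > 0 \<Longrightarrow> twice_differentiable (\<lambda>y. \<phi> y t)"
    and a: "\<And>x t. t > 0 \<Longrightarrow> transpose (a x t) = a x t" "\<And>x t v. t > 0 \<Longrightarrow> 0 \<le> v \<bullet> (a x t *v v)"
    and strict: "\<And>x t. t > 0 \<Longrightarrow> \<phi>t x t < elliptic_op (a x t) (\<lambda>y. \<phi> y t) x"
    and initial: "\<And>x. \<phi> x 0 \<le> 0"
    and far: "\<And>x t. t \<ge> 0 \<Longrightarrow> norm x \<ge> R \<Longrightarrow> \<phi> x t \<le> 0"
    and "t\<^sub>1 \<ge> 0"
  shows "\<phi> x\<^sub>1 t\<^sub>1 \<le> 0"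
proof (rule ccontr)
  assume "\<not> ?thesis"
  then have pos: "\<phi> x\<^sub>1 t\<^sub>1 > 0" by simp
  define K where "K = cball (0 :: real^'n) R \<times> {0..t\<^sub>1}"
  have x1: "(x\<^sub>1, t\<^sub>1) \<in> K"
    using far[of t\<^sub>1 x\<^sub>1] pos \<open>t\<^sub>1 \<ge> 0\<close> by (cases "norm x\<^sub>1 \<ge> R") (auto simp: K_def)
  have "compact K" unfolding K_def by (intro compact_Times) auto
  moreover have "continuous_on K (\<lambda>(x, t). \<phi> x t)"
    by (rule continuous_on_subset[OF cont]) (auto simp: K_def)
  ultimately obtain p where p: "p \<in> K" "\<And>q. q \<in> K \<Longrightarrow> (\<lambda>(x, t). \<phi> x t) q \<le> (\<lambda>(x, t). \<phi> x t) p"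
    using continuous_attains_sup[of K "\<lambda>(x, t). \<phi> x t"] x1 by blast
  obtain x t where xt: "p = (x, t)" by (cases p)
  have max: "\<phi> y s \<le> \<phi> x t" if "norm y \<le> R" "0 \<le> s" "s \<le> t\<^sub>1" for y s
    using p(2)[of "(y, s)"] that by (simp add: xt K_def)
  have pos': "\<phi> x t > 0" using p(2)[OF x1] pos by (simp add: xt)
  have t: "0 \<le> t" "t \<le> t\<^sub>1" using p(1) by (auto simp: xt K_def)
  then have "t > 0" using initial[of x] pos' by (cases "t = 0") auto
  have x: "norm x < R" using far[of t x] pos' t by (cases "norm x \<ge> R") auto
  have "\<phi>t x t \<ge> 0"
  proof (rule ccontr)
    assume "\<not> ?thesis"
    then obtain e where e: "e > 0" "\<And>h. 0 < h \<Longrightarrow> h < e \<Longrightarrow> \<phi> x t < \<phi> x (t - h)"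
      using DERIV_neg_dec_left[OF dt[OF \<open>t > 0\<close>, of x]] by auto
    define h where "h = min e t / 2"
    have "0 < h" "h < e" "h \<le> t" using e(1) \<open>t > 0\<close> by (auto simp: h_def min_def)
    then show False using e(2)[of h] max[of x "t - h"] x t by auto
  qed
  moreover have "v \<bullet> ((\<chi> i j. partial j (partial i (\<lambda>y. \<phi> y t)) x) *v v) \<le> 0" for v
  proof -
    have "((\<chi> i j. partial j (partial i (\<lambda>y. \<phi> y t)) x) *v v) \<bullet> v \<le> 0"
    proof (rule second_derivative_test)
      show "((\<lambda>y. \<phi> y t) has_derivative (\<lambda>v. (\<chi> i. partial i (\<lambda>y. \<phi> y t) y) \<bullet> v)) (at y)" for y
        using tw[OF \<open>t > 0\<close>] by (intro has_derivative_partials) (simp add: twice_differentiable_def)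
      show "((\<lambda>y. \<chi> i. partial i (\<lambda>y. \<phi> y t) y) has_derivative
          (\<lambda>v. (\<chi> i j. partial j (partial i (\<lambda>y. \<phi> y t)) x) *v v)) (at x)"
        using tw[OF \<open>t > 0\<close>] by (intro has_derivative_gradient) (simp add: twice_differentiable_def)
      show "0 < R - norm x" using x by simp
      fix y assume "dist x y < R - norm x"
      then have "norm y \<le> R"
        using norm_triangle_ineq2[of y x] by (simp add: dist_norm norm_minus_commute)
      then show "\<phi> y t \<le> \<phi> x t" using max t by blast
    qed
    then show ?thesis by (simp add: inner_commute)
  qed
  then have "(\<Sum>i\<in>UNIV. \<Sum>j\<in>UNIV. a x t $ i $ j *
      (\<chi> i j. partial j (partial i (\<lambda>y. \<phi> y t)) x) $ i $ j) \<le> 0"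
    using a \<open>t > 0\<close> by (intro trace_psd_nsd_nonpos) auto
  then have "elliptic_op (a x t) (\<lambda>y. \<phi> y t) x \<le> 0" by (simp add: elliptic_op_def)
  ultimately show False using strict[OF \<open>t > 0\<close>, of x] by linarith
qed

lemma
  assumes "twice_differentiable f" "twice_differentiable g"
  shows twice_differentiable_diff: "twice_differentiable (\<lambda>y. f y - g y)"
    and elliptic_op_diff: "elliptic_op A (\<lambda>y. f y - g y) x = elliptic_op A f x - elliptic_op A g x"
proof -
  have "partial i (\<lambda>y. f y - g y) = (\<lambda>y. partial i f y - partial i g y)" for i
    using assms by (auto simp: twice_differentiable_def partial_diff)
  then show "twice_differentiable (\<lambda>y. f y - g y)"
    "elliptic_op A (\<lambda>y. f y - g y) x = elliptic_op A f x - elliptic_op A g x"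
    using assms by (auto simp: twice_differentiable_def elliptic_op_def partial_diff algebra_simps
        sum_subtractf)
qed

lemma
  assumes "twice_differentiable f"
  shows twice_differentiable_cmult: "twice_differentiable (\<lambda>y. c * f y)"
    and elliptic_op_cmult: "elliptic_op A (\<lambda>y. c * f y) x = c * elliptic_op A f x"
proof -
  have "partial i (\<lambda>y. c * f y) = (\<lambda>y. c * partial i f y)" for i
    using assms by (auto simp: twice_differentiable_def partial_cmult)
  then show "twice_differentiable (\<lambda>y. c * f y)" "elliptic_op A (\<lambda>y. c * f y) x
      = c * elliptic_op A f x"
    using assms by (auto simp: twice_differentiable_def elliptic_op_def partial_cmult
        algebra_simps sum_distrib_left)
qed

lemma
  assumes "twice_differentiable f"
  shows twice_differentiable_diff_const: "twice_differentiable (\<lambda>y. f y - c)"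
    and elliptic_op_diff_const: "elliptic_op A (\<lambda>y. f y - c) x = elliptic_op A f x"
proof -
  have "partial i (\<lambda>y. f y - c) = partial i f" for i
    using assms by (auto simp: twice_differentiable_def partial_diff partial_const)
  then show "twice_differentiable (\<lambda>y. f y - c)" "elliptic_op A (\<lambda>y. f y - c) x = elliptic_op A f x"
    using assms by (auto simp: twice_differentiable_def elliptic_op_def)
qed

lemma differentiable_nth: "(\<lambda>y. y $ i) differentiable (at x)" for x :: "real^'n::finite"
  by (rule bounded_linear_imp_differentiable) (rule bounded_linear_vec_nth)

lemma partial_nth: "partial j (\<lambda>y. y $ i) x = (if i = j then 1 else 0)"
  using partial_unique[OF bounded_linear_imp_has_derivative[OF bounded_linear_vec_nth[of i]], of j x]
  by (simp add: axis_def)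

lemma partial_inner_self: "partial i (\<lambda>y. y \<bullet> y) x = 2 * x $ i"
proof -
  have "((\<lambda>y. y \<bullet> y) has_derivative (\<lambda>h. x \<bullet> h + h \<bullet> x)) (at x)"
    by (auto intro!: derivative_eq_intros)
  from partial_unique[OF this] show ?thesis by (simp add: inner_axis inner_axis')
qed

lemma trace_mult_delta: "(\<Sum>i\<in>UNIV. \<Sum>j\<in>UNIV. A $ i $ j * (if i = j then c else 0)) = c * trace A"
  for A :: "real^'n::finite^'n" and c :: real
  by (simp add: trace_def sum_distrib_left if_distrib mult.commute cong: if_cong)

lemma
  fixes A :: "real^'n::finite^'n"
  shows twice_differentiable_inner_self: "twice_differentiable (\<lambda>y::real^'n. y \<bullet> y)"
    and elliptic_op_inner_self: "elliptic_op A (\<lambda>y. y \<bullet> y) x = 2 * trace A"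
proof -
  have p: "partial i (\<lambda>y::real^'n. y \<bullet> y) = (\<lambda>y. 2 * y $ i)" for i :: 'n
    by (rule ext) (rule partial_inner_self)
  show "twice_differentiable (\<lambda>y::real^'n. y \<bullet> y)"
    unfolding twice_differentiable_def p
    by (intro conjI allI differentiable_mult differentiable_const differentiable_nth)
      (simp add: inner_vec_def differentiable_sum differentiable_mult differentiable_nth)
  show "elliptic_op A (\<lambda>y. y \<bullet> y) x = 2 * trace A"
    unfolding elliptic_op_def p
    using trace_mult_delta[of A 2]
    by (simp add: partial_cmult differentiable_nth partial_nth if_distrib cong: if_cong)
qed

lemma differentiable_gaussian: "(\<lambda>y. exp (- \<kappa> * (y \<bullet> y))) differentiable (at (x::real^'n::finite))"
  and partial_gaussian: "partial i (\<lambda>y. exp (- \<kappa> * (y \<bullet> y))) x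
      = - 2 * \<kappa> * (x $ i * exp (- \<kappa> * (x \<bullet> x)))"
proof -
  have d: "((\<lambda>y. exp (- \<kappa> * (y \<bullet> y))) has_derivative
      (\<lambda>h. - \<kappa> * (x \<bullet> h + h \<bullet> x) * exp (- \<kappa> * (x \<bullet> x)))) (at x)"
    by (auto intro!: derivative_eq_intros simp: algebra_simps)
  then show "(\<lambda>y. exp (- \<kappa> * (y \<bullet> y))) differentiable (at x)" by (auto simp: differentiable_def)
  from partial_unique[OF d] show "partial i (\<lambda>y. exp (- \<kappa> * (y \<bullet> y))) x
      = - 2 * \<kappa> * (x $ i * exp (- \<kappa> * (x \<bullet> x)))"
    by (simp add: inner_axis inner_axis')
qed

lemma
  fixes A :: "real^'n::finite^'n"
  shows twice_differentiable_gaussian: "twice_differentiable (\<lambda>y::real^'n. exp (- \<kappa> * (y \<bullet> y)))"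
    and elliptic_op_gaussian: "elliptic_op A (\<lambda>y. exp (- \<kappa> * (y \<bullet> y))) x
    = exp (- \<kappa> * (x \<bullet> x)) * (4 * \<kappa>\<^sup>2 * (x \<bullet> (A *v x)) - 2 * \<kappa> * trace A)"
proof -
  have p: "partial i (\<lambda>y::real^'n. exp (- \<kappa> * (y \<bullet> y))) = (\<lambda>y. - 2 * \<kappa> * (y $ i * exp (- \<kappa> * (y \<bullet>
      y))))" for i :: 'n
    by (rule ext) (rule partial_gaussian)
  show "twice_differentiable (\<lambda>y::real^'n. exp (- \<kappa> * (y \<bullet> y)))"
    unfolding twice_differentiable_def p
    by (intro conjI allI differentiable_mult differentiable_const differentiable_nth
        differentiable_gaussian)
  have "partial j (partial i (\<lambda>y. exp (- \<kappa> * (y \<bullet> y)))) x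
      = exp (- \<kappa> * (x \<bullet> x)) * (4 * \<kappa>\<^sup>2 * (x $ i * x $ j) - 2 * \<kappa> * (if i = j then 1 else 0))" for i j
  proof -
    have "partial j (partial i (\<lambda>y. exp (- \<kappa> * (y \<bullet> y)))) x
       = - 2 * \<kappa> * (partial j (\<lambda>y. y $ i) x * exp (- \<kappa> * (x \<bullet> x))
           + x $ i * partial j (\<lambda>y. exp (- \<kappa> * (y \<bullet> y))) x)"
      unfolding p
      by (simp only: partial_cmult partial_mult differentiable_mult differentiable_nth
          differentiable_gaussian
          partial_gaussian)
    then show ?thesis
      unfolding partial_gaussian partial_nth by (simp add: algebra_simps power2_eq_square)
  qed
  then have "elliptic_op A (\<lambda>y. exp (- \<kappa> * (y \<bullet> y))) x
      = exp (- \<kappa> * (x \<bullet> x)) * (4 * \<kappa>\<^sup>2 * (\<Sum>i\<in>UNIV. \<Sum>j\<in>UNIV. x $ i * A $ i $ j * x $ j)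
        - 2 * \<kappa> * (\<Sum>i\<in>UNIV. \<Sum>j\<in>UNIV. A $ i $ j * (if i = j then 1 else 0)))"
    unfolding elliptic_op_def
    by (simp only: sum_distrib_left right_diff_distrib sum_subtractf mult_ac)
  then show "elliptic_op A (\<lambda>y. exp (- \<kappa> * (y \<bullet> y))) x
    = exp (- \<kappa> * (x \<bullet> x)) * (4 * \<kappa>\<^sup>2 * (x \<bullet> (A *v x)) - 2 * \<kappa> * trace A)"
    by (simp only: trace_mult_delta inner_matrix_vector mult_1)
qed

section \<open>Decay of subsolutions\<close>

text \<open>A heat kernel with modified exponents. For ellipticity constants \<open>1 / 2\<close> and \<open>2\<close>, the
factor \<open>1 / (8 (1 + t))\<close> in the exponent lets the time derivative absorb the quadratic part of
the Hessian, and the rate \<open>1 / 8\<close> is admissible because the trace of the coefficients is at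
least \<open>1 / 2\<close>.\<close>

definition barrier :: "real^'n::finite \<Rightarrow> real \<Rightarrow> real" where
  "barrier x t = (1 + t) powr (- 1 / 8) * exp (- (1 / (8 * (1 + t))) * (x \<bullet> x))"

lemma barrier_time_derivative:
  assumes "t > 0"
  shows "((\<lambda>s. barrier x s) has_real_derivative
    barrier x t * (- 1 / (8 * (1 + t)) + (x \<bullet> x) / (8 * (1 + t)\<^sup>2))) (at t)"
proof -
  have "(\<lambda>s. barrier x s) = (\<lambda>s. (1 + s) powr (- 1 / 8) * exp (- (x \<bullet> x) / (8 * (1 + s))))"
    by (simp add: barrier_def)
  moreover have "((\<lambda>s. (1 + s) powr (- 1 / 8) * exp (- (x \<bullet> x) / (8 * (1 + s)))) has_real_derivative
    (- 1 / 8) * (1 + t) powr (- 1 / 8 - 1) * exp (- (x \<bullet> x) / (8 * (1 + t)))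
    + (1 + t) powr (- 1 / 8) * (exp (- (x \<bullet> x) / (8 * (1 + t))) * ((x \<bullet> x) / (8 * (1 + t)\<^sup>2))))
        (at t)"
  proof -
    have "((\<lambda>s. - (x \<bullet> x) / (8 * (1 + s))) has_real_derivative (x \<bullet> x) / (8 * (1 + t)\<^sup>2)) (at t)"
      using assms by (auto intro!: derivative_eq_intros simp: divide_simps power2_eq_square)
        (simp add: algebra_simps)
    moreover have "((\<lambda>s. (1 + s) powr (- 1 / 8)) has_real_derivative (- 1 / 8) * (1 + t) powr (- 1
        / 8 - 1)) (at t)"
      using assms by (auto intro!: derivative_eq_intros)
    ultimately show ?thesis
      by (intro DERIV_cong[OF DERIV_mult[OF _ DERIV_fun_exp]]) (assumption+, simp)
  qed
  moreover have "(1 + t) powr (- 1 / 8 - 1) = (1 + t) powr (- 1 / 8) / (1 + t)"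
    using powr_diff[of "1 + t" "- 1 / 8" 1] assms by simp
  ultimately show ?thesis by (simp add: barrier_def algebra_simps)
qed

lemma twice_differentiable_barrier: "twice_differentiable (\<lambda>y. barrier y t)"
  unfolding barrier_def by (intro twice_differentiable_cmult twice_differentiable_gaussian)

text \<open>The right-hand side is the time derivative of the barrier.\<close>

lemma barrier_supersolution:
  fixes A :: "real^'n::finite^'n"
  assumes "t > 0" and A: "\<And>w. (w \<bullet> w) / 2 \<le> w \<bullet> (A *v w)" "\<And>w. w \<bullet> (A *v w) \<le> 2 * (w \<bullet> w)"
  shows "elliptic_op A (\<lambda>y. barrier y t) x
    \<le> barrier x t * (- 1 / (8 * (1 + t)) + (x \<bullet> x) / (8 * (1 + t)\<^sup>2))"
proof -
  define \<kappa> where "\<kappa> = 1 / (8 * (1 + t))"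
  have \<kappa>: "\<kappa> > 0" using assms(1) by (simp add: \<kappa>_def)
  have "elliptic_op A (\<lambda>y. barrier y t) x = barrier x t * (4 * \<kappa>\<^sup>2 * (x \<bullet> (A *v x)) - 2 * \<kappa> *
      trace A)"
    unfolding barrier_def \<kappa>_def[symmetric]
    by (simp only: elliptic_op_cmult[OF twice_differentiable_gaussian] elliptic_op_gaussian
        mult.assoc)
  also have "\<dots> \<le> barrier x t * (4 * \<kappa>\<^sup>2 * (2 * (x \<bullet> x)) - 2 * \<kappa> * (1 / 2))"
    using A(2)[of x] trace_bounds(1)[OF A] \<kappa>
    by (intro mult_left_mono diff_mono) (simp_all add: barrier_def)
  also have "\<dots> = barrier x t * (- 1 / (8 * (1 + t)) + (x \<bullet> x) / (8 * (1 + t)\<^sup>2))"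
  proof -
    define s where "s = 1 + t"
    have "s > 0" using assms(1) by (simp add: s_def)
    then have "4 * \<kappa>\<^sup>2 * (2 * (x \<bullet> x)) - 2 * \<kappa> * (1 / 2) = - 1 / (8 * s) + (x \<bullet> x) / (8 * s\<^sup>2)"
      unfolding \<kappa>_def s_def[symmetric] by (simp add: field_simps power2_eq_square)
    then show ?thesis by (simp only: s_def)
  qed
  finally show ?thesis .
qed

lemma continuous_on_barrier: "continuous_on (UNIV \<times> {0..}) (\<lambda>(x, t). barrier x t)"
  unfolding barrier_def split_def by (intro continuous_intros) auto

text \<open>The initial values lie below \<open>\<delta> + C * barrier x 0\<close>: far out because they are small there,
and on the remaining ball because the barrier has a positive minimum there. The maximum
principle applies to the difference after subtraction of \<open>\<eta> (x \<bullet> x + K t)\<close>, which makes it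
nonpositive far out and the inequality strict; then \<open>\<eta>\<close> tends to \<open>0\<close>.\<close>

lemma subsolution_decay:
  fixes u ut :: "real^'n::finite \<Rightarrow> real \<Rightarrow> real" and a :: "real^'n \<Rightarrow> real \<Rightarrow> real^'n^'n"
  assumes cont: "continuous_on (UNIV \<times> {0..}) (\<lambda>(x, t). u x t)"
    and dt: "\<And>x t. t > 0 \<Longrightarrow> ((\<lambda>s. u x s) has_real_derivative ut x t) (at t)"
    and tw: "\<And>t. t > 0 \<Longrightarrow> twice_differentiable (\<lambda>y. u y t)"
    and sym: "\<And>x t. t > 0 \<Longrightarrow> transpose (a x t) = a x t"
    and a: "\<And>x t w. t > 0 \<Longrightarrow> (w \<bullet> w) / 2 \<le> w \<bullet> (a x t *v w)"
      "\<And>x t w. t > 0 \<Longrightarrow> w \<bullet> (a x t *v w) \<le> 2 * (w \<bullet> w)"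
    and sub: "\<And>x t. t > 0 \<Longrightarrow> ut x t \<le> elliptic_op (a x t) (\<lambda>y. u y t) x"
    and M: "\<And>x t. t \<ge> 0 \<Longrightarrow> u x t \<le> M"
    and initial: "\<And>\<delta>. \<delta> > 0 \<Longrightarrow> \<exists>R. \<forall>x. norm x \<ge> R \<longrightarrow> u x 0 \<le> \<delta>"
    and "e > 0"
  shows "\<forall>\<^sub>F t in at_top. \<forall>x. u x t < e"
proof -
  define \<delta> where "\<delta> = e / 2"
  have \<delta>: "\<delta> > 0" using \<open>e > 0\<close> by (simp add: \<delta>_def)
  obtain R where R: "\<And>x. norm x \<ge> R \<Longrightarrow> u x 0 \<le> \<delta>" using initial[OF \<delta>] by blast
  \<comment> \<open>On the ball of radius \<open>R\<close> the initial barrier is at least \<open>exp (- R\<^sup>2 / 8)\<close>.\<close>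
  define C where "C = \<bar>M\<bar> * exp (R\<^sup>2 / 8)"
  have C: "C \<ge> 0" by (simp add: C_def)
  have start: "u x 0 \<le> \<delta> + C * barrier x 0" for x
  proof (cases "norm x \<ge> R")
    case True
    then show ?thesis using R[OF True] C by (simp add: barrier_def add_increasing2)
  next
    case False
    then have "x \<bullet> x \<le> R\<^sup>2" 
      by (metis dot_square_norm norm_ge_zero not_le less_imp_le power_mono)
    then have "1 \<le> exp (R\<^sup>2 / 8) * exp (- (1 / 8) * (x \<bullet> x))" by (simp flip: exp_add)
    then have "\<bar>M\<bar> * 1 \<le> \<bar>M\<bar> * (exp (R\<^sup>2 / 8) * exp (- (1 / 8) * (x \<bullet> x)))"
      by (intro mult_left_mono) auto
    also have "\<dots> = C * barrier x 0" by (simp add: C_def barrier_def)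
    finally show ?thesis using M[of 0 x] \<delta> by linarith
  qed
  \<comment> \<open>The trace of \<open>a\<close> is at most \<open>2 n\<close>, so that \<open>x \<bullet> x + K t\<close> is a strict supersolution; it
    confines a positive maximum to a bounded region.\<close>
  define K where "K = 4 * real CARD('n) + 1"
  have bound: "u x t \<le> \<delta> + C * barrier x t + \<eta> * (x \<bullet> x + K * t)"
    if "\<eta> > 0" and t: "t \<ge> 0" for \<eta> x t
  proof -
    define \<phi> where "\<phi> x t = ((u x t - C * barrier x t) - \<eta> * (x \<bullet> x)) - (\<delta> + \<eta> * K * t)" for x t
    have "\<phi> x t \<le> 0"
    proof (rule parabolic_maximum_principle[where \<phi> = \<phi> and a = a and R = "\<bar>M\<bar> / \<eta> + 1" and
          \<phi>t = "\<lambda>x t. (ut x t - C * (barrier x t * (- 1 / (8 * (1 + t)) + (x \<bullet> x) / (8 * (1 +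
              t)\<^sup>2)))) - \<eta> * K"])
      show "continuous_on (UNIV \<times> {0..}) (\<lambda>(x, t). \<phi> x t)"
        using cont continuous_on_barrier unfolding \<phi>_def split_def by (intro continuous_intros)
      show "((\<lambda>s. \<phi> x s) has_real_derivative
          (ut x t - C * (barrier x t * (- 1 / (8 * (1 + t)) + (x \<bullet> x) / (8 * (1 + t)\<^sup>2)))) - \<eta> *
              K) (at t)"
        if "t > 0" for x t
        unfolding \<phi>_def
        by (rule derivative_eq_intros dt barrier_time_derivative that refl | simp)+
      show "twice_differentiable (\<lambda>y. \<phi> y t)" if "t > 0" for t
        unfolding \<phi>_def
        by (intro twice_differentiable_diff_const twice_differentiable_diff twice_differentiable_cmult
            tw[OF that] twice_differentiable_barrier twice_differentiable_inner_self)
      show "transpose (a x t) = a x t" if "t > 0" for x t by (rule sym[OF that])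
      show "0 \<le> v \<bullet> (a x t *v v)" if "t > 0" for x t v
        by (rule order_trans[OF _ a(1)[OF that]]) simp
      show "(ut x t - C * (barrier x t * (- 1 / (8 * (1 + t)) + (x \<bullet> x) / (8 * (1 + t)\<^sup>2)))) - \<eta> * K
          < elliptic_op (a x t) (\<lambda>y. \<phi> y t) x" if "t > 0" for x t
      proof -
        have "elliptic_op (a x t) (\<lambda>y. \<phi> y t) x = elliptic_op (a x t) (\<lambda>y. u y t) x
            - C * elliptic_op (a x t) (\<lambda>y. barrier y t) x - \<eta> * (2 * trace (a x t))"
          unfolding \<phi>_def
          by (simp only: elliptic_op_diff_const elliptic_op_diff elliptic_op_cmult
              elliptic_op_inner_self
              twice_differentiable_diff twice_differentiable_cmult tw[OF that]
              twice_differentiable_barrier twice_differentiable_inner_self)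
        moreover have "C * elliptic_op (a x t) (\<lambda>y. barrier y t) x
            \<le> C * (barrier x t * (- 1 / (8 * (1 + t)) + (x \<bullet> x) / (8 * (1 + t)\<^sup>2)))"
          by (intro mult_left_mono barrier_supersolution that a C)
        moreover have "2 * trace (a x t) < K"
          using trace_bounds(2)[OF a[OF that], of x] unfolding K_def by linarith
        then have "\<eta> * (2 * trace (a x t)) < \<eta> * K"
          using \<open>\<eta> > 0\<close> by (rule mult_strict_left_mono)
        ultimately show ?thesis using sub[OF that, of x] by linarith
      qed
      show "\<phi> x 0 \<le> 0" for x
        using start[of x] \<open>\<eta> > 0\<close> by (simp add: \<phi>_def) (smt (verit) mult_nonneg_nonneg inner_ge_zero)
      show "\<phi> x t \<le> 0" if "t \<ge> 0" "norm x \<ge> \<bar>M\<bar> / \<eta> + 1" for x t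
      proof -
        have "\<bar>M\<bar> / \<eta> \<ge> 0" using \<open>\<eta> > 0\<close> by simp
        then have "norm x * 1 \<le> norm x * norm x" using that by (intro mult_left_mono) auto
        then have "\<bar>M\<bar> / \<eta> \<le> x \<bullet> x"
          using that by (simp add: dot_square_norm power2_eq_square)
        then have "\<bar>M\<bar> \<le> \<eta> * (x \<bullet> x)" using \<open>\<eta> > 0\<close> by (simp add: field_simps)
        moreover have "0 \<le> C * barrier x t" using C by (simp add: barrier_def)
        moreover have "0 \<le> \<eta> * K * t" using \<open>\<eta> > 0\<close> that by (simp add: K_def)
        ultimately show ?thesis using M[OF that(1), of x] \<delta> by (simp add: \<phi>_def)
      qed
    qed (rule t)
    then show ?thesis by (simp add: \<phi>_def algebra_simps)
  qed
  have decay: "u x t \<le> \<delta> + C * (1 + t) powr (- 1 / 8)" if t: "t \<ge> 0" for x t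
  proof -
    have "u x t \<le> \<delta> + C * barrier x t"
    proof (rule field_le_epsilon)
      fix \<eta> :: real assume \<eta>: "\<eta> > 0"
      \<comment> \<open>The bound with slack \<open>\<eta> / c\<close> at the fixed point \<open>(x, t)\<close>.\<close>
      define c where "c = x \<bullet> x + K * t + 1"
      have c: "c > 0" using t by (simp add: c_def K_def add_nonneg_pos)
      have "u x t \<le> \<delta> + C * barrier x t + \<eta> / c * (x \<bullet> x + K * t)"
        using \<eta> c t by (intro bound) auto
      also have "\<eta> / c * (x \<bullet> x + K * t) \<le> \<eta> / c * c"
        using \<eta> c by (intro mult_left_mono) (auto simp: c_def)
      finally show "u x t \<le> \<delta> + C * barrier x t + \<eta>" using c by simp
    qed
    also have "C * barrier x t \<le> C * ((1 + t) powr (- 1 / 8) * 1)"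
      unfolding barrier_def using t by (intro mult_left_mono C) auto
    finally show ?thesis by simp
  qed
  have "((\<lambda>t. C * (1 + t) powr (- 1 / 8)) \<longlongrightarrow> C * 0) at_top"
    by (intro tendsto_mult tendsto_const tendsto_neg_powr filterlim_tendsto_add_at_top[OF
        tendsto_const filterlim_ident]) auto
  then have "\<forall>\<^sub>F t in at_top. C * (1 + t) powr (- 1 / 8) < \<delta>"
    using \<delta> by (intro order_tendstoD(2)) auto
  then show ?thesis
    using eventually_ge_at_top[of 0]
  proof eventually_elim
    case (elim t)
    then show ?case using decay[OF elim(2)] by (smt (verit) \<delta>_def field_sum_of_halves)
  qed
qed

section \<open>The h-flow in standard coordinates\<close>

lemma sum_mult_delta:
  fixes f :: "'n::finite \<Rightarrow> real"
  shows "(\<Sum>k\<in>UNIV. (if i = k then 1 else 0) * f k) = f i"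
  by (simp add: if_distrib if_distribR cong: if_cong)

lemma abs_sum_le_card:
  fixes f :: "'n::finite \<Rightarrow> real"
  assumes "\<And>i. \<bar>f i\<bar> \<le> c"
  shows "\<bar>\<Sum>i\<in>UNIV. f i\<bar> \<le> real CARD('n) * c"
proof -
  have "\<bar>\<Sum>i\<in>UNIV. f i\<bar> \<le> (\<Sum>i\<in>(UNIV::'n set). c)"
    by (rule order_trans[OF sum_abs sum_mono]) (use assms in auto)
  then show ?thesis by simp
qed

lemma abs_mult_le: "\<bar>a\<bar> \<le> c \<Longrightarrow> \<bar>b\<bar> \<le> d \<Longrightarrow> \<bar>a * b\<bar> \<le> c * d" for a b c d :: real
  unfolding abs_mult by (intro mult_mono) auto

locale twice_differentiable_metric =
  fixes G :: "'n::finite tensor_field"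
  assumes sym: "\<And>y. transpose (G y) = G y"
    and inv: "\<And>y. invertible (G y)"
    and diff: "\<And>y. G differentiable (at y)"
    and diff2: "\<And>i y. coord_deriv i G differentiable (at y)"

begin

abbreviation B where "B y \<equiv> matrix_inv (G y)"

abbreviation D where "D i y \<equiv> coord_deriv i G y"

abbreviation H where "H m i y \<equiv> coord_deriv m (coord_deriv i G) y"

text \<open>Christoffel symbols of the first kind, with the lowered index in front.\<close>

definition christoffel1 where "christoffel1 l i j y = (1/2) * (D i y $ j $ l + D j y $ i $ l - D l
    y $ i $ j)"

text \<open>Contracted with the inverse metric, these form the second-order part of the derivatives of
the Christoffel symbols.\<close>

definition dchristoffel1 where "dchristoffel1 m l i j y = (1/2) * (H m i y $ j $ l + H m j y $ i $
    l - H m l y $ i $ j)"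

lemma G_sym: "G y $ i $ j = G y $ j $ i"
proof -
  have "transpose (G y) $ i $ j = G y $ i $ j" by (simp only: sym)
  then show ?thesis by (simp add: transpose_def)
qed

lemma B_sym: "B y $ i $ j = B y $ j $ i"
proof -
  have "transpose (B y) ** G y = transpose (G y ** B y)"
    by (simp only: matrix_transpose_mul sym)
  then have 1: "transpose (B y) ** G y = mat 1"
    by (simp only: matrix_inv_mult(1)[OF inv] transpose_mat)
  have "transpose (B y) = transpose (B y) ** (G y ** B y)"
    by (simp only: matrix_inv_mult(1)[OF inv] matrix_mul_rid)
  also have "\<dots> = B y"
    by (simp only: matrix_mul_assoc 1 matrix_mul_lid)
  finally have "transpose (B y) $ i $ j = B y $ i $ j" by simp
  then show ?thesis by (simp add: transpose_def)
qed

lemma GB: "(\<Sum>k\<in>UNIV. G y $ i $ k * B y $ k $ l) = (if i = l then 1 else 0)"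
  using matrix_inv_mult(1)[OF inv[of y]] by (simp add: matrix_matrix_mult_def mat_def vec_eq_iff)

lemma BG: "(\<Sum>k\<in>UNIV. B y $ i $ k * G y $ k $ l) = (if i = l then 1 else 0)"
  using matrix_inv_mult(2)[OF inv[of y]] by (simp add: matrix_matrix_mult_def mat_def vec_eq_iff)

lemma D_sym: "D m y $ i $ j = D m y $ j $ i"
  using partial_entry[OF diff[of y], of m i j] partial_entry[OF diff[of y], of m j i]
  by (simp add: G_sym)

lemma H_sym: "H m l y $ i $ j = H m l y $ j $ i"
proof -
  have "(\<lambda>z. D l z $ i $ j) = (\<lambda>z. D l z $ j $ i)" by (rule ext) (rule D_sym)
  then show ?thesis
    using partial_entry[OF diff2[of l y], of m i j] partial_entry[OF diff2[of l y], of m j i] by simp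
qed

lemma diff_entries:
  "(\<lambda>y. G y $ i $ j) differentiable (at y)"
  "(\<lambda>y. B y $ i $ j) differentiable (at y)"
  "(\<lambda>y. D m y $ i $ j) differentiable (at y)"
  by (intro differentiable_vec_nth diff diff2 differentiable_matrix_inv inv)+

text \<open>Differentiation of \<open>G ** B = mat 1\<close>.\<close>

lemma partial_B: "partial m (\<lambda>y. B y $ k $ l) y
    = - (\<Sum>p\<in>UNIV. \<Sum>q\<in>UNIV. B y $ k $ p * D m y $ p $ q * B y $ q $ l)"
proof -
  define E where "E q = partial m (\<lambda>y. B y $ q $ l) y" for q
  have "(\<Sum>q\<in>UNIV. D m y $ p $ q * B y $ q $ l + G y $ p $ q * E q) = 0" for p
  proof -
    have "partial m (\<lambda>y. \<Sum>q\<in>UNIV. G y $ p $ q * B y $ q $ l) y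
        = (\<Sum>q\<in>UNIV. D m y $ p $ q * B y $ q $ l + G y $ p $ q * E q)"
      by (simp add: partial_sum partial_mult diff_entries differentiable_mult partial_entry diff
          E_def)
    then show ?thesis by (simp add: GB partial_const)
  qed
  then have "0 = (\<Sum>p\<in>UNIV. B y $ k $ p * (\<Sum>q\<in>UNIV. D m y $ p $ q * B y $ q $ l + G y $ p $ q * E q))"
    by simp
  also have "\<dots> = (\<Sum>p\<in>UNIV. \<Sum>q\<in>UNIV. B y $ k $ p * D m y $ p $ q * B y $ q $ l)
      + (\<Sum>p\<in>UNIV. \<Sum>q\<in>UNIV. B y $ k $ p * G y $ p $ q * E q)"
    by (simp add: sum_distrib_left sum.distrib algebra_simps)
  also have "(\<Sum>p\<in>UNIV. \<Sum>q\<in>UNIV. B y $ k $ p * G y $ p $ q * E q)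
      = (\<Sum>q\<in>UNIV. (\<Sum>p\<in>UNIV. B y $ k $ p * G y $ p $ q) * E q)"
    by (subst sum.swap) (simp add: sum_distrib_right)
  also have "\<dots> = E k" by (simp add: BG sum_mult_delta)
  finally show ?thesis by (simp add: E_def)
qed

lemma christoffel_eq: "christoffel G k i j y = (\<Sum>l\<in>UNIV. B y $ k $ l * christoffel1 l i j y)"
  by (simp add: christoffel_def christoffel1_def partial_entry diff sum_distrib_left algebra_simps)

lemma differentiable_christoffel1: "christoffel1 l i j differentiable (at y)"
  unfolding christoffel1_def[abs_def]
  by (intro differentiable_mult differentiable_diff differentiable_add differentiable_const
      diff_entries)

lemma partial_christoffel1: "partial m (christoffel1 l i j) y = dchristoffel1 m l i j y"
  unfolding christoffel1_def[abs_def] dchristoffel1_def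
  by (simp only: partial_cmult partial_diff partial_add differentiable_add differentiable_diff
      diff_entries partial_entry diff2)

lemma partial_christoffel: "partial m (christoffel G k i j) y
    = (\<Sum>l\<in>UNIV. partial m (\<lambda>y. B y $ k $ l) y * christoffel1 l i j y + B y $ k $ l * dchristoffel1
        m l i j y)"
proof -
  have "christoffel G k i j = (\<lambda>y. \<Sum>l\<in>UNIV. B y $ k $ l * christoffel1 l i j y)"
    by (rule ext) (rule christoffel_eq)
  then show ?thesis
    by (simp add: partial_sum partial_mult differentiable_christoffel1 diff_entries
        differentiable_mult partial_christoffel1)
qed

lemma christoffel_std: "christoffel std_metric k i j y = 0"
  by (simp add: christoffel_def std_metric_def partial_const)

text \<open>Lowering the index of \<open>V\<close> cancels the inverse metric in the Christoffel symbols.\<close>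

lemma deturck_eq:
  "deturck_form std_metric G i y = (\<Sum>r\<in>UNIV. \<Sum>s\<in>UNIV. B y $ r $ s * christoffel1 i r s y)"
proof -
  have "deturck_form std_metric G i y
      = (\<Sum>r\<in>UNIV. \<Sum>s\<in>UNIV. B y $ r $ s * (\<Sum>k\<in>UNIV. G y $ i $ k * christoffel G k r s y))"
    unfolding deturck_form_def christoffel_std
    by (subst sum.swap, rule sum.cong[OF refl], subst sum.swap)
      (simp add: sum_distrib_left mult_ac)
  moreover have "(\<Sum>k\<in>UNIV. G y $ i $ k * christoffel G k r s y) = christoffel1 i r s y" for r s
  proof -
    have "(\<Sum>k\<in>UNIV. G y $ i $ k * christoffel G k r s y)
        = (\<Sum>l\<in>UNIV. (\<Sum>k\<in>UNIV. G y $ i $ k * B y $ k $ l) * christoffel1 l r s y)"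
      unfolding christoffel_eq sum_distrib_left sum_distrib_right
      by (subst sum.swap) (simp add: mult_ac)
    then show ?thesis by (simp add: GB sum_mult_delta)
  qed
  ultimately show ?thesis by simp
qed

lemma partial_deturck: "partial m (deturck_form std_metric G i) y
    = (\<Sum>r\<in>UNIV. \<Sum>s\<in>UNIV. partial m (\<lambda>y. B y $ r $ s) y * christoffel1 i r s y + B y $ r $ s *
        dchristoffel1 m i r s y)"
proof -
  have "deturck_form std_metric G i = (\<lambda>y. \<Sum>r\<in>UNIV. \<Sum>s\<in>UNIV. B y $ r $ s * christoffel1 i r s y)"
    by (rule ext) (rule deturck_eq)
  then show ?thesis
    by (simp add: partial_sum partial_mult differentiable_christoffel1 diff_entries
        differentiable_mult differentiable_sum partial_christoffel1)
qed

definition flow_velocity where "flow_velocity i j y = - 2 * ricci G i j y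
        + nabla1 G i (deturck_form std_metric G) j y
        + nabla1 G j (deturck_form std_metric G) i y"

text \<open>The part of the Ricci tensor that is quadratic in the first derivatives of the metric.\<close>

definition quad_ricci where "quad_ricci i j y =
  (\<Sum>k\<in>UNIV. (\<Sum>l\<in>UNIV. partial k (\<lambda>y. B y $ k $ l) y * christoffel1 l i j y)
    - (\<Sum>l\<in>UNIV. partial i (\<lambda>y. B y $ k $ l) y * christoffel1 l k j y)
    + (\<Sum>l\<in>UNIV. christoffel G k k l y * christoffel G l i j y
                  - christoffel G k i l y * christoffel G l k j y))"

text \<open>The part of \<open>\<nabla>\<^sub>i V\<^sub>j\<close> that is quadratic in the first derivatives of the metric.\<close>

definition quad_nabla where "quad_nabla i j y =
  (\<Sum>r\<in>UNIV. \<Sum>s\<in>UNIV. partial i (\<lambda>y. B y $ r $ s) y * christoffel1 j r s y)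
  - (\<Sum>k\<in>UNIV. christoffel G k i j y * deturck_form std_metric G k y)"

text \<open>DeTurck's observation: the second derivatives \<open>H i k\<close>, \<open>H j k\<close> and \<open>H i j\<close>, which spoil
the ellipticity of the Ricci tensor, are compensated by those in \<open>\<nabla>\<^sub>i V\<^sub>j + \<nabla>\<^sub>j V\<^sub>i\<close>, and \<open>g\<^sup>k\<^sup>l
\<partial>\<^sub>k \<partial>\<^sub>l g\<^sub>i\<^sub>j\<close> is left.\<close>

lemma flow_velocity_eq:
  assumes schwarz: "\<And>k l. H k l y = H l k y"
  shows "flow_velocity i j y = (\<Sum>k\<in>UNIV. \<Sum>l\<in>UNIV. B y $ k $ l * H k l y $ i $ j)
    + (- 2 * quad_ricci i j y + quad_nabla i j y + quad_nabla j i y)"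
proof -
  define S where "S f = (\<Sum>k\<in>UNIV. \<Sum>l\<in>UNIV. B y $ k $ l * f k l)" for f :: "'n \<Rightarrow> 'n \<Rightarrow> real"
  have ric: "ricci G i j y = S (\<lambda>k l. dchristoffel1 k l i j y) - S (\<lambda>k l. dchristoffel1 i l k j y)
      + quad_ricci i j y"
    unfolding ricci_def quad_ricci_def partial_christoffel S_def
    by (simp add: sum.distrib sum_subtractf algebra_simps)
  have nab: "nabla1 G i (deturck_form std_metric G) j y = S (\<lambda>k l. dchristoffel1 i j k l y) +
      quad_nabla i j y" for i j
    unfolding nabla1_def quad_nabla_def partial_deturck S_def
    by (simp add: sum.distrib algebra_simps)
  have S_swap: "S f = S (\<lambda>k l. f l k)" for f
    unfolding S_def by (subst sum.swap) (simp add: B_sym)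
  have S_add: "S f + S g = S (\<lambda>k l. f k l + g k l)" "S f - S g = S (\<lambda>k l. f k l - g k l)"
    "c * S f = S (\<lambda>k l. c * f k l)" for f g c
    unfolding S_def by (simp_all add: sum.distrib sum_subtractf sum_distrib_left algebra_simps)
  have half: "S (\<lambda>k l. f k l - f l k) = 0" for f
    using S_swap[of f] by (simp add: S_add(2)[symmetric])
  \<comment> \<open>After cancellation what remains besides \<open>H k l\<close> is antisymmetric in \<open>k\<close> and \<open>l\<close>.\<close>
  define f where "f k l = H i k y $ l $ j / 2 + H j l y $ k $ i / 2" for k l
  have "- 2 * (S (\<lambda>k l. dchristoffel1 k l i j y) - S (\<lambda>k l. dchristoffel1 i l k j y)) + S (\<lambda>k l.
      dchristoffel1 i j k l y) + S (\<lambda>k l. dchristoffel1 j i k l y)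
     = S (\<lambda>k l. H k l y $ i $ j + (f k l - f l k))"
    unfolding S_add
  proof (rule arg_cong[of _ _ S], intro ext)
    fix k l
    have "H i j y = H j i y" "H k i y = H i k y" "H k j y = H j k y" "H l i y = H i l y" "H l j y
        = H j l y"
      using schwarz by blast+
    moreover have "H i k y $ j $ l = H i k y $ l $ j" "H i l y $ k $ j = H i l y $ j $ k" 
     "H j k y $ l $ i = H j k y $ i $ l" "H j l y $ k $ i = H j l y $ i $ k" by (rule H_sym)+
    ultimately show "- 2 * (dchristoffel1 k l i j y - dchristoffel1 i l k j y) + dchristoffel1 i j
        k l y + dchristoffel1 j i k l y
      = H k l y $ i $ j + (f k l - f l k)"
      by (simp add: dchristoffel1_def f_def field_simps)
  qed
  also have "\<dots> = S (\<lambda>k l. H k l y $ i $ j)"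
    using half[of f] by (simp add: S_add(1)[symmetric])
  finally show ?thesis
    unfolding flow_velocity_def ric nab by (simp add: S_def algebra_simps)
qed

text \<open>Termwise estimates. The Ricci part contributes \<open>2 * 30\<close> and each of the two parts of the
symmetrised derivative of \<open>V\<close> contributes \<open>15\<close> to the constant.\<close>

lemma quad_bound:
  assumes B: "\<And>k l. \<bar>B y $ k $ l\<bar> \<le> 2" and d: "\<And>m k l. \<bar>D m y $ k $ l\<bar> \<le> d"
  shows "\<bar>- 2 * quad_ricci i j y + quad_nabla i j y + quad_nabla j i y\<bar>
      \<le> 90 * real CARD('n) ^ 4 * d\<^sup>2"
proof -
  define N where "N = real CARD('n)"
  note sum_le = abs_sum_le_card[where 'n='n, folded N_def]
  have C1: "\<bar>christoffel1 l i j y\<bar> \<le> 3/2 * d" for l i j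
    using d[of i j l] d[of j i l] d[of l i j] by (simp add: christoffel1_def)
  have dB: "\<bar>partial m (\<lambda>y. B y $ k $ l) y\<bar> \<le> N * (N * (2 * d * 2))" for m k l
    unfolding partial_B abs_minus_cancel by (intro sum_le abs_mult_le B d)
  have \<Gamma>: "\<bar>christoffel G k i j y\<bar> \<le> N * (2 * (3/2 * d))" for k i j
    unfolding christoffel_eq by (intro sum_le abs_mult_le B C1)
  have V: "\<bar>deturck_form std_metric G k y\<bar> \<le> N * (N * (2 * (3/2 * d)))" for k
    unfolding deturck_eq by (intro sum_le abs_mult_le B C1)
  have EL: "\<bar>\<Sum>l\<in>UNIV. partial m (\<lambda>y. B y $ k $ l) y * christoffel1 (p l) (q l) (r l) y\<bar>
      \<le> N * (N * (N * (2 * d * 2)) * (3/2 * d))"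
    for m k p q r
    by (intro sum_le abs_mult_le dB C1)
  have EL: "\<bar>\<Sum>l\<in>UNIV. partial m (\<lambda>y. B y $ k $ l) y * christoffel1 (p l) (q l) (r l) y\<bar>
      \<le> 6 * N^3 * d\<^sup>2" for m k p q r
    using EL[of m k p q r] by (simp add: power2_eq_square power3_eq_cube algebra_simps)
  have GG1: "\<bar>christoffel G k i l y * christoffel G k' i' l' y\<bar> \<le> 9 * N^2 * d\<^sup>2" for k i l k' i' l'
    using abs_mult_le[OF \<Gamma>[of k i l] \<Gamma>[of k' i' l']] by (simp add: power2_eq_square algebra_simps)
  have GG: "\<bar>\<Sum>l\<in>UNIV. christoffel G k k l y * christoffel G l i j y
      - christoffel G k i l y * christoffel G l k j y\<bar> \<le> 18 * N^3 * d\<^sup>2" for k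
  proof -
    have "\<bar>\<Sum>l\<in>UNIV. christoffel G k k l y * christoffel G l i j y
      - christoffel G k i l y * christoffel G l k j y\<bar> \<le> N * (18 * N^2 * d\<^sup>2)"
    proof (rule sum_le)
      fix l 
      show "\<bar>christoffel G k k l y * christoffel G l i j y - christoffel G k i l y * christoffel G
          l k j y\<bar> \<le> 18 * N^2 * d\<^sup>2"
        using GG1[of k k l l i j] GG1[of k i l l k j] by linarith
    qed
    then show ?thesis by (simp add: power2_eq_square power3_eq_cube algebra_simps)
  qed
  have ric: "\<bar>quad_ricci i j y\<bar> \<le> N * (30 * N^3 * d\<^sup>2)"
    unfolding quad_ricci_def
  proof (rule sum_le)
    fix k
    show "\<bar>(\<Sum>l\<in>UNIV. partial k (\<lambda>y. B y $ k $ l) y * christoffel1 l i j y)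
    - (\<Sum>l\<in>UNIV. partial i (\<lambda>y. B y $ k $ l) y * christoffel1 l k j y)
    + (\<Sum>l\<in>UNIV. christoffel G k k l y * christoffel G l i j y
                  - christoffel G k i l y * christoffel G l k j y)\<bar> \<le> 30 * N^3 * d\<^sup>2"
      using EL[of k k "\<lambda>l. l" "\<lambda>_. i" "\<lambda>_. j"] EL[of i k "\<lambda>l. l" "\<lambda>_. k" "\<lambda>_. j"] GG[of k] by linarith
  qed
  have nab: "\<bar>quad_nabla i j y\<bar> \<le> 15 * N^4 * d\<^sup>2" for i j
  proof -
    have "\<bar>\<Sum>r\<in>UNIV. \<Sum>s\<in>UNIV. partial i (\<lambda>y. B y $ r $ s) y * christoffel1 j r s y\<bar>
        \<le> N * (6 * N^3 * d\<^sup>2)"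
      by (rule sum_le) (rule EL)
    moreover have "\<bar>\<Sum>k\<in>UNIV. christoffel G k i j y * deturck_form std_metric G k y\<bar>
        \<le> N * ((N * (2 * (3/2 * d))) * (N * (N * (2 * (3/2 * d)))))"
      by (intro sum_le abs_mult_le \<Gamma> V)
    ultimately show ?thesis
      unfolding quad_nabla_def by (simp add: power2_eq_square power3_eq_cube power4_eq_xxxx
          algebra_simps)
  qed
  have "\<bar>- 2 * quad_ricci i j y + quad_nabla i j y + quad_nabla j i y\<bar>
      \<le> 2 * (N * (30 * N^3 * d\<^sup>2)) + 15 * N^4 * d\<^sup>2 + 15 * N^4 * d\<^sup>2"
    using ric nab[of i j] nab[of j i] by linarith
  then show ?thesis by (simp add: N_def power2_eq_square power3_eq_cube power4_eq_xxxx algebra_simps)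
qed

end

section \<open>The squared distance to the Euclidean metric\<close>

lemma sum_swap_pairs:
  fixes f :: "'a \<Rightarrow> 'b \<Rightarrow> 'c \<Rightarrow> 'd \<Rightarrow> 'e::comm_monoid_add"
  shows "(\<Sum>k\<in>A. \<Sum>l\<in>B. \<Sum>i\<in>C. \<Sum>j\<in>D. f k l i j) = (\<Sum>i\<in>C. \<Sum>j\<in>D. \<Sum>k\<in>A. \<Sum>l\<in>B. f k l i j)"
proof -
  have swap: "(\<Sum>l\<in>S. \<Sum>i\<in>C. \<Sum>j\<in>D. h l i j) = (\<Sum>i\<in>C. \<Sum>j\<in>D. \<Sum>l\<in>S. h l i j)"
    for S and h :: "'x \<Rightarrow> 'c \<Rightarrow> 'd \<Rightarrow> 'e"
    by (subst sum.swap) (intro sum.cong refl sum.swap)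
  have "(\<Sum>k\<in>A. \<Sum>l\<in>B. \<Sum>i\<in>C. \<Sum>j\<in>D. f k l i j) = (\<Sum>k\<in>A. \<Sum>i\<in>C. \<Sum>j\<in>D. \<Sum>l\<in>B. f k l i j)"
    by (intro sum.cong refl swap)
  also have "\<dots> = (\<Sum>i\<in>C. \<Sum>j\<in>D. \<Sum>k\<in>A. \<Sum>l\<in>B. f k l i j)"
    by (rule swap)
  finally show ?thesis .
qed

context twice_differentiable_metric
begin

definition dist_sq where "dist_sq y = (\<Sum>i\<in>UNIV. \<Sum>j\<in>UNIV. ((G y - mat 1) $ i $ j)\<^sup>2)"

lemma diff_Z: "(\<lambda>y. (G y - mat 1) $ i $ j) differentiable (at y)"
  and partial_Z: "partial k (\<lambda>y. (G y - mat 1) $ i $ j) y = D k y $ i $ j"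
proof -
  have "(\<lambda>y. (G y - mat 1) $ i $ j) = (\<lambda>y. G y $ i $ j - mat 1 $ i $ j)" by simp
  then show "(\<lambda>y. (G y - mat 1) $ i $ j) differentiable (at y)"
    "partial k (\<lambda>y. (G y - mat 1) $ i $ j) y = D k y $ i $ j"
    by (simp_all only: partial_diff partial_const partial_entry diff diff_entries differentiable_const
        differentiable_diff diff_0_right)
qed

lemma differentiable_dist_sq: "dist_sq differentiable (at y)"
  and partial_dist_sq: "partial k dist_sq = (\<lambda>y. \<Sum>i\<in>UNIV. \<Sum>j\<in>UNIV. 2 * ((G y - mat 1) $ i $ j * D
      k y $ i $ j))"
proof -
  have dist_sq: "dist_sq = (\<lambda>y. \<Sum>i\<in>UNIV. \<Sum>j\<in>UNIV. (G y - mat 1) $ i $ j * (G y - mat 1) $ i $ j)"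
    by (simp add: dist_sq_def[abs_def] power2_eq_square)
  show "dist_sq differentiable (at y)" unfolding dist_sq
    by (intro differentiable_sum ballI differentiable_mult diff_Z finite)
  show "partial k dist_sq = (\<lambda>y. \<Sum>i\<in>UNIV. \<Sum>j\<in>UNIV. 2 * ((G y - mat 1) $ i $ j * D k y $ i $ j))"
    unfolding dist_sq
    by (rule ext) (simp only: partial_sum partial_mult differentiable_sum differentiable_mult
        diff_Z finite
        partial_Z ball_UNIV simp_thms mult.commute mult_2)
qed

lemma twice_differentiable_dist_sq: "twice_differentiable dist_sq"
  unfolding twice_differentiable_def partial_dist_sq
  by (intro conjI allI differentiable_dist_sq differentiable_sum ballI differentiable_mult diff_Z
      diff_entries
      differentiable_const finite)

lemma elliptic_op_dist_sq:
  "elliptic_op (B y) dist_sq y = 2 * (\<Sum>i\<in>UNIV. \<Sum>j\<in>UNIV. 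
    (\<Sum>k\<in>UNIV. \<Sum>l\<in>UNIV. B y $ k $ l * (D k y $ i $ j * D l y $ i $ j))
     + (G y - mat 1) $ i $ j * (\<Sum>k\<in>UNIV. \<Sum>l\<in>UNIV. B y $ k $ l * H l k y $ i $ j))"
proof -
  have "partial l (partial k dist_sq) y
     = (\<Sum>i\<in>UNIV. \<Sum>j\<in>UNIV. 2 * (D k y $ i $ j * D l y $ i $ j + (G y - mat 1) $ i $ j * H l k y $ i
         $ j))"
    for k l
    unfolding partial_dist_sq
    by (simp only: partial_sum partial_cmult partial_mult differentiable_sum differentiable_mult
        diff_Z finite
        partial_Z diff_entries differentiable_const partial_entry diff2 ball_UNIV simp_thms
            mult.commute add.commute)
  then have "elliptic_op (B y) dist_sq y = (\<Sum>k\<in>UNIV. \<Sum>l\<in>UNIV. \<Sum>i\<in>UNIV. \<Sum>j\<in>UNIV.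
     2 * (B y $ k $ l * (D k y $ i $ j * D l y $ i $ j) + (G y - mat 1) $ i $ j * (B y $ k $ l * H
         l k y $ i $ j)))"
    (is "_ = (\<Sum>k\<in>UNIV. \<Sum>l\<in>UNIV. \<Sum>i\<in>UNIV. \<Sum>j\<in>UNIV. ?f k l i j)")
    by (simp only: elliptic_op_def sum_distrib_left) (simp only: algebra_simps)
  also have "\<dots> = (\<Sum>i\<in>UNIV. \<Sum>j\<in>UNIV. \<Sum>k\<in>UNIV. \<Sum>l\<in>UNIV. ?f k l i j)"
    by (rule sum_swap_pairs)
  finally show ?thesis
    by (simp only: sum_distrib_left sum.distrib distrib_left)
qed

text \<open>By \<open>elliptic_op_dist_sq\<close> and \<open>flow_velocity_eq\<close>, the difference of the two sides is \<open>2
(g\<^sup>k\<^sup>l \<langle>\<partial>\<^sub>k g, \<partial>\<^sub>l g\<rangle> - \<langle>g - h, Q\<rangle>) \<ge> d\<^sup>2 (1 - 180 n\<^sup>6 z)\<close> with \<open>d = |\<partial> g|\<close>: the gradient term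
is at least \<open>d\<^sup>2 / 2\<close> by ellipticity, and the quadratic term is at most \<open>n\<^sup>2 z\<close> times the bound
for \<open>Q\<close>.\<close>

lemma dist_sq_subsolution:
  assumes schwarz: "\<And>k l. H k l y = H l k y"
    and B: "\<And>k l. \<bar>B y $ k $ l\<bar> \<le> 2" "\<And>w. (w \<bullet> w) / 2 \<le> w \<bullet> (B y *v w)"
    and Z: "\<And>i j. \<bar>(G y - mat 1) $ i $ j\<bar> \<le> z" and z: "180 * real CARD('n) ^ 6 * z \<le> 1"
  shows "(\<Sum>i\<in>UNIV. \<Sum>j\<in>UNIV. 2 * ((G y - mat 1) $ i $ j * flow_velocity i j y))
      \<le> elliptic_op (B y) dist_sq y"
proof -
  define N where "N = real CARD('n)"
  define Q where "Q i j = - 2 * quad_ricci i j y + quad_nabla i j y + quad_nabla j i y" for i j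
  define E where "E i j = (\<Sum>k\<in>UNIV. (D k y $ i $ j)\<^sup>2)" for i j
  \<comment> \<open>The Euclidean norm of the full first derivative, which dominates each of its components.\<close>
  define d where "d = sqrt (\<Sum>i\<in>UNIV. \<Sum>j\<in>UNIV. E i j)"
  have E0: "E i j \<ge> 0" for i j by (simp add: E_def sum_nonneg)
  then have d2: "d\<^sup>2 = (\<Sum>i\<in>UNIV. \<Sum>j\<in>UNIV. E i j)" by (simp add: d_def sum_nonneg)
  have "(D m y $ k $ l)\<^sup>2 \<le> d\<^sup>2" for m k l
  proof -
    have "(D m y $ k $ l)\<^sup>2 \<le> E k l"
      unfolding E_def by (rule member_le_sum) auto
    also have "\<dots> \<le> (\<Sum>j\<in>UNIV. E k j)" using E0 by (intro member_le_sum) auto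
    also have "\<dots> \<le> (\<Sum>i\<in>UNIV. \<Sum>j\<in>UNIV. E i j)"
      using E0 by (intro member_le_sum[of k UNIV "\<lambda>i. \<Sum>j\<in>UNIV. E i j"]) (auto intro: sum_nonneg)
    finally show ?thesis by (simp add: d2)
  qed
  moreover have "d \<ge> 0" using E0 by (simp add: d_def sum_nonneg)
  ultimately have D: "\<bar>D m y $ k $ l\<bar> \<le> d" for m k l
    by (metis abs_le_square_iff abs_of_nonneg)
  have Q: "\<bar>Q i j\<bar> \<le> 90 * N ^ 4 * d\<^sup>2" for i j
    unfolding Q_def N_def by (rule quad_bound[OF B(1) D])
  have "0 \<le> z" using Z[of undefined undefined] by linarith
  define T where "T i j = (\<Sum>k\<in>UNIV. \<Sum>l\<in>UNIV. B y $ k $ l * (D k y $ i $ j * D l y $ i $ j))" for i j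
  define R where "R i j = (\<Sum>k\<in>UNIV. \<Sum>l\<in>UNIV. B y $ k $ l * H k l y $ i $ j)" for i j
  have ell: "elliptic_op (B y) dist_sq y = 2 * (\<Sum>i\<in>UNIV. \<Sum>j\<in>UNIV. T i j + (G y - mat 1) $ i $ j *
      R i j)"
    by (simp only: elliptic_op_dist_sq T_def R_def schwarz)
  have flow_velocity: "flow_velocity i j y = R i j + Q i j" for i j
    by (simp only: flow_velocity_eq[OF schwarz] R_def Q_def)
  have main: "elliptic_op (B y) dist_sq y - (\<Sum>i\<in>UNIV. \<Sum>j\<in>UNIV. 2 * ((G y - mat 1) $ i $ j *
      flow_velocity i j y))
    = 2 * (\<Sum>i\<in>UNIV. \<Sum>j\<in>UNIV. T i j - (G y - mat 1) $ i $ j * Q i j)"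
    unfolding ell flow_velocity
    by (simp only: sum_distrib_left sum_subtractf[symmetric]) (simp add: algebra_simps)
  have "(\<Sum>i\<in>UNIV. \<Sum>j\<in>UNIV. T i j - (G y - mat 1) $ i $ j * Q i j)
      \<ge> (\<Sum>i\<in>UNIV. \<Sum>j\<in>UNIV. E i j / 2 - z * (90 * N ^ 4 * d\<^sup>2))"
  proof (intro sum_mono diff_mono)
    fix i j
    show "E i j / 2 \<le> T i j"
      using B(2)[of "\<chi> k. D k y $ i $ j"]
      by (simp add: inner_matrix_vector, simp add: inner_vec_def E_def T_def power2_eq_square
          algebra_simps)
    show "(G y - mat 1) $ i $ j * Q i j \<le> z * (90 * N ^ 4 * d\<^sup>2)"
      using abs_mult_le[OF Z[of i j] Q[of i j]] by linarith
  qed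
  also have "(\<Sum>i\<in>UNIV. \<Sum>j\<in>UNIV. E i j / 2 - z * (90 * N ^ 4 * d\<^sup>2))
      = d\<^sup>2 / 2 - N * (N * (z * (90 * N ^ 4 * d\<^sup>2)))"
    unfolding sum_subtractf d2 sum_divide_distrib[symmetric] by (simp add: N_def)
  also have "\<dots> = (d\<^sup>2 / 2) * (1 - 180 * N ^ 6 * z)"
    by (simp add: algebra_simps power2_eq_square eval_nat_numeral)
  finally have "(\<Sum>i\<in>UNIV. \<Sum>j\<in>UNIV. T i j - (G y - mat 1) $ i $ j * Q i j)
      \<ge> (d\<^sup>2 / 2) * (1 - 180 * N ^ 6 * z)" .
  moreover have "(d\<^sup>2 / 2) * (1 - 180 * N ^ 6 * z) \<ge> 0" using z by (simp add: N_def)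
  ultimately show ?thesis using main by linarith
qed

end

section \<open>Convergence to the Euclidean metric\<close>

lemma SUP_ereal_tendsto_zero:
  fixes f :: "real \<Rightarrow> 'a \<Rightarrow> real"
  assumes "\<And>e. e > 0 \<Longrightarrow> \<forall>\<^sub>F t in F. \<forall>x. f t x \<le> e" and "\<And>t x. 0 \<le> f t x"
  shows "((\<lambda>t. SUP x. ereal (f t x)) \<longlongrightarrow> 0) F"
proof (rule order_tendstoI)
  fix a :: ereal assume "a < 0"
  have "0 \<le> (SUP x. ereal (f t x))" for t
    using assms(2) by (intro SUP_upper2[of undefined]) auto
  then show "\<forall>\<^sub>F t in F. a < (SUP x. ereal (f t x))"
    using \<open>a < 0\<close> by (intro always_eventually allI) (rule less_le_trans)
next
  fix a :: ereal assume "0 < a"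
  then obtain e where e: "0 < ereal e" "ereal e < a" using ereal_dense2 by blast
  have "\<forall>\<^sub>F t in F. \<forall>x. f t x \<le> e" using assms(1) e by simp
  then show "\<forall>\<^sub>F t in F. (SUP x. ereal (f t x)) < a"
  proof eventually_elim
    case (elim t)
    then have "(SUP x. ereal (f t x)) \<le> ereal e" by (intro SUP_least) simp
    then show ?case using e(2) by (rule le_less_trans)
  qed
qed

lemma norm_nabla_tendsto_zero:
  fixes g :: "real \<Rightarrow> 'n::finite tensor_field"
  assumes "\<And>vs. set vs \<subseteq> Basis \<Longrightarrow> length vs = k \<Longrightarrow>
    uniform_limit UNIV (\<lambda>t. iter_deriv UNIV vs (g t)) (\<lambda>_. 0) at_top"
  shows "((\<lambda>t. SUP x. ereal (norm_nabla k (g t) x)) \<longlongrightarrow> 0) at_top"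
proof (rule SUP_ereal_tendsto_zero)
  define V where "V = {vs :: (real^'n) list. set vs \<subseteq> Basis \<and> length vs = k}"
  have V: "finite V" unfolding V_def by (rule finite_lists_length_eq) simp
  fix e :: real assume e: "e > 0"
  define e' where "e' = e / (real (card V) + 1)"
  have e': "e' > 0" using e by (simp add: e'_def add_nonneg_pos)
  have "\<forall>\<^sub>F t in at_top. \<forall>vs\<in>V. \<forall>x\<in>UNIV. dist (iter_deriv UNIV vs (g t) x) 0 < e'"
    by (intro eventually_ball_finite V ballI uniform_limitD e' assms) (auto simp: V_def)
  then show "\<forall>\<^sub>F t in at_top. \<forall>x. norm_nabla k (g t) x \<le> e"
  proof eventually_elim
    case (elim t)
    have "norm_nabla k (g t) x \<le> e" for x
    proof -
      have "norm_nabla k (g t) x \<le> (\<Sum>vs\<in>V. norm (iter_deriv UNIV vs (g t) x))"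
        unfolding norm_nabla_def V_def[symmetric] L2_set_def[symmetric] by (rule L2_set_le_sum) simp
      also have "\<dots> \<le> (\<Sum>vs\<in>V. e')"
        using elim by (intro sum_mono) (auto simp: less_imp_le)
      also have "\<dots> \<le> (real (card V) + 1) * e'" using e' by simp
      also have "\<dots> = e" by (simp add: e'_def add_nonneg_pos less_imp_neq[symmetric])
      finally show ?thesis .
    qed
    then show ?case by blast
  qed
qed (simp add: norm_nabla_def sum_nonneg)

text \<open>The squared distance satisfies the hypotheses of \<open>subsolution_decay\<close>. Closeness \<open>\<epsilon>'\<close>
bounds the entries of \<open>g t x - mat 1\<close> by \<open>z = 4 \<epsilon>'\<close>, so that the condition \<open>180 n\<^sup>6 z \<le> 1\<close> of
\<open>dist_sq_subsolution\<close> becomes \<open>720 n\<^sup>6 \<epsilon>' \<le> 1\<close>.\<close>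

lemma flow_tendsto_std_metric:
  fixes g :: "real \<Rightarrow> 'n::finite tensor_field"
  assumes smooth: "g \<in> metrics \<infinity> {0<..}" and cont: "g \<in> metrics_loc 0 {0..}"
    and flow: "h_flow std_metric g\<^sub>0 g"
    and close: "\<And>t. t \<ge> 0 \<Longrightarrow> close_on UNIV \<epsilon>' (g t) std_metric"
    and \<epsilon>': "\<epsilon>' > 0" "720 * real CARD('n) ^ 6 * \<epsilon>' \<le> 1"
    and initial: "\<And>r. r > 0 \<Longrightarrow> close_on (UNIV - ball 0 r) (\<epsilon> r) g\<^sub>0 std_metric"
    and \<epsilon>: "(\<epsilon> \<longlongrightarrow> 0) at_top"
  shows "uniform_limit UNIV g (\<lambda>_. mat 1) at_top"
proof -
  define F where "F = (\<lambda>(x, t). g t x)"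
  have F: "Ck_on \<infinity> (UNIV \<times> {0<..}) F" using smooth by (simp add: metrics_def F_def)
  have F_slice: "(\<lambda>x. F (x, t)) = g t" for t by (simp add: F_def)
  define N where "N = real CARD('n)"
  have N: "N \<ge> 1" by (simp add: N_def Suc_le_eq)
  then have "1 * \<epsilon>' \<le> N ^ 6 * \<epsilon>'" using \<epsilon>'(1) by (intro mult_right_mono) auto
  then have small: "\<epsilon>' \<le> 1 / 2" using \<epsilon>'(2) by (simp add: N_def)
  have sym: "transpose (g t x) = g t x" if "t \<ge> 0" for t x
    using cont that by (auto simp: metrics_loc_def riemannian_metric_def)
  have closeD: "inverse (1 + \<epsilon>') * (v \<bullet> v) \<le> v \<bullet> (g t x *v v)" "v \<bullet> (g t x *v v) \<le> (1 + \<epsilon>') * (v \<bullet> v)"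
    if "t \<ge> 0" for t x v
    using close[OF that] by (simp_all add: close_on_def std_metric_def)
  have inv: "1 / 2 \<le> inverse (1 + \<epsilon>')" using \<epsilon>'(1) small by (simp add: field_simps)
  have lower: "(v \<bullet> v) / 2 \<le> v \<bullet> (g t x *v v)" and upper: "v \<bullet> (g t x *v v) \<le> 2 * (v \<bullet> v)"
    if "t \<ge> 0" for t x v
  proof -
    have "1 / 2 * (v \<bullet> v) \<le> inverse (1 + \<epsilon>') * (v \<bullet> v)" by (intro mult_right_mono inv) auto
    then show "(v \<bullet> v) / 2 \<le> v \<bullet> (g t x *v v)" using closeD(1)[OF that, of v x] by linarith
    have "(1 + \<epsilon>') * (v \<bullet> v) \<le> 2 * (v \<bullet> v)" using small by (intro mult_right_mono) auto
    then show "v \<bullet> (g t x *v v) \<le> 2 * (v \<bullet> v)" using closeD(2)[OF that, of v x] by linarith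
  qed
  have Z: "\<bar>(g t x - mat 1) $ i $ j\<bar> \<le> 4 * \<epsilon>'" if "t \<ge> 0" for t x i j
    using close_entries[OF sym[OF that] _ closeD[OF that], of x i j] small \<epsilon>'(1) by simp
  note inverse = inverse_bounds[OF sym lower upper]
  have tdm: "twice_differentiable_metric (g t)"
    and schwarz: "coord_deriv i (coord_deriv j (g t)) x = coord_deriv j (coord_deriv i (g t)) x"
    if "t > 0" for t i j x
  proof -
    have d0: "g t differentiable (at y)" for y
      using iter_deriv_slice(2)[OF F, of "[]" t y] that by (simp add: F_slice)
    have d1: "coord_deriv i (g t) differentiable (at y)" for i y
      using iter_deriv_slice(2)[OF F, of "[axis i 1]" t y] that axis_mem_Basis
      unfolding coord_deriv_eq_iter_deriv[symmetric] by (simp add: F_slice)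
    have d2: "coord_deriv i (coord_deriv j (g t)) differentiable (at y)" for i j y
      using iter_deriv_slice(2)[OF F, of "[axis i 1, axis j 1]" t y] that axis_mem_Basis
      unfolding coord_deriv_eq_iter_deriv[symmetric] by (simp add: F_slice)
    show "twice_differentiable_metric (g t)"
      using sym inverse(1) d0 d1 that by unfold_locales auto
    show "coord_deriv i (coord_deriv j (g t)) x = coord_deriv j (coord_deriv i (g t)) x"
      by (rule coord_deriv_commute[OF d0 d1 d2])
  qed
  define u where "u x t = (\<Sum>i\<in>UNIV. \<Sum>j\<in>UNIV. ((g t x - mat 1) $ i $ j)\<^sup>2)" for x t
  have u_norm: "u x t = (norm (g t x - mat 1))\<^sup>2" for x t
    by (simp only: u_def norm_square_entries)
  have u_eq: "(\<lambda>y. u y t) = twice_differentiable_metric.dist_sq (g t)" if "t > 0" for t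
    by (rule ext) (simp only: u_def twice_differentiable_metric.dist_sq_def[OF tdm[OF that]])
  have cont_g: "continuous_on (UNIV \<times> {0..}) (\<lambda>(x, t). g t x)"
  proof -
    have "Ck_loc_on 0 (UNIV \<times> {0..}) (\<lambda>(x, t). g t x)" using cont by (simp add: metrics_loc_def)
    then show ?thesis unfolding Ck_loc_on_def by (auto simp: zero_enat_def dest!: spec[of _ "[]"])
  qed
  \<comment> \<open>Both are the limit of \<open>g t x\<close> for \<open>t\<close> decreasing to \<open>0\<close>.\<close>
  have g0: "g 0 x = g\<^sub>0 x" for x
  proof -
    have "continuous_on {0..} (\<lambda>t. (\<lambda>(x, t). g t x) (x, t))"
      by (rule continuous_on_compose2[OF cont_g]) (auto intro!: continuous_intros)
    then have "((\<lambda>t. g t x) \<longlongrightarrow> g 0 x) (at 0 within {0..})"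
      by (auto simp: continuous_on_def)
    then have "((\<lambda>t. g t x) \<longlongrightarrow> g 0 x) (at_right 0)"
      by (rule tendsto_within_subset) auto
    moreover have "compact {x}" by simp
    then have "uniform_limit {x} g g\<^sub>0 (at_right 0)"
      using flow unfolding h_flow_def by blast
    then have "((\<lambda>t. g t x) \<longlongrightarrow> g\<^sub>0 x) (at_right 0)"
      by (rule tendsto_uniform_limitI) simp
    ultimately show ?thesis by (intro tendsto_unique[of "at_right 0"]) auto
  qed
  have decay: "\<forall>\<^sub>F t in at_top. \<forall>x. u x t < e" if "e > 0" for e
  proof (rule subsolution_decay[where a = "\<lambda>x t. matrix_inv (g t x)" and M = "(N * (4 * \<epsilon>'))\<^sup>2"])
    show "continuous_on (UNIV \<times> {0..}) (\<lambda>(x, t). u x t)"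
      using cont_g unfolding u_norm split_def by (intro continuous_intros)
    fix x :: "real^'n" and t :: real assume t: "t > 0"
    define rhs where "rhs = twice_differentiable_metric.flow_velocity (g t)"
    have "((\<lambda>s. g s x $ i $ j) has_real_derivative rhs i j x) (at t)" for i j
      using flow t unfolding rhs_def twice_differentiable_metric.flow_velocity_def[OF tdm[OF t]]
      by (simp add: h_flow_def)
    then show "((\<lambda>s. u x s) has_real_derivative
        (\<Sum>i\<in>UNIV. \<Sum>j\<in>UNIV. 2 * ((g t x - mat 1) $ i $ j *
            twice_differentiable_metric.flow_velocity (g t) i j x))) (at t)"
      unfolding u_def rhs_def[symmetric]
      by (intro DERIV_sum) (auto intro!: derivative_eq_intros)
    show "twice_differentiable (\<lambda>y. u y t)"
      unfolding u_eq[OF t] by (rule twice_differentiable_metric.twice_differentiable_dist_sq[OF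
          tdm[OF t]])
    show "transpose (matrix_inv (g t x)) = matrix_inv (g t x)"
      using twice_differentiable_metric.B_sym[OF tdm[OF t]] by (simp add: transpose_def vec_eq_iff)
    show "(w \<bullet> w) / 2 \<le> w \<bullet> (matrix_inv (g t x) *v w)" "w \<bullet> (matrix_inv (g t x) *v w)
        \<le> 2 * (w \<bullet> w)" for w
      using inverse t by simp_all
    show "(\<Sum>i\<in>UNIV. \<Sum>j\<in>UNIV. 2 * ((g t x - mat 1) $ i $ j *
        twice_differentiable_metric.flow_velocity (g t) i j x))
        \<le> elliptic_op (matrix_inv (g t x)) (\<lambda>y. u y t) x"
      unfolding u_eq[OF t]
      by (rule twice_differentiable_metric.dist_sq_subsolution[OF tdm[OF t], where z = "4 * \<epsilon>'"])
        (use schwarz inverse Z t \<epsilon>'(2) in auto)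
  next
    show "u x t \<le> (N * (4 * \<epsilon>'))\<^sup>2" if "t \<ge> 0" for x t
      unfolding u_norm N_def by (intro norm_square_le_entries Z that)
  next
    fix \<delta> :: real assume \<delta>: "\<delta> > 0"
    \<comment> \<open>Closeness \<open>c\<close> bounds the entries of \<open>g 0 - mat 1\<close> by \<open>4 c\<close>, hence its norm by \<open>4 N c\<close>.\<close>
    define c where "c = min (1 / 2) (sqrt \<delta> / (4 * N))"
    have c: "c > 0" using \<delta> N by (simp add: c_def)
    have "\<forall>\<^sub>F r in at_top. \<bar>\<epsilon> r\<bar> < c \<and> r > 0"
      using tendstoD[OF \<epsilon> c] eventually_gt_at_top[of 0] by (simp add: eventually_conj)
    then obtain r where r: "\<bar>\<epsilon> r\<bar> < c" "r > 0" 
      using eventually_happens[of _ at_top] by (metis (mono_tags, lifting)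
          trivial_limit_at_top_linorder)
    show "\<exists>R. \<forall>x. norm x \<ge> R \<longrightarrow> u x 0 \<le> \<delta>"
    proof (intro exI[of _ r] allI impI)
      fix x :: "real^'n" assume "r \<le> norm x"
      then have x: "x \<in> UNIV - ball 0 r" by simp
      have "\<bar>(g 0 x - mat 1) $ i $ j\<bar> \<le> 4 * \<bar>\<epsilon> r\<bar>" for i j
      proof (rule close_entries)
        show "\<bar>\<epsilon> r\<bar> \<le> 1 / 2" using r(1) by (simp add: c_def)
      qed (use initial[OF r(2)] x g0 sym[of 0 x] in \<open>auto simp: close_on_def std_metric_def\<close>)
      then have "u x 0 \<le> (N * (4 * \<bar>\<epsilon> r\<bar>))\<^sup>2"
        unfolding u_norm N_def by (rule norm_square_le_entries)
      also have "\<dots> \<le> (sqrt \<delta>)\<^sup>2"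
      proof (rule power_mono)
        have "\<bar>\<epsilon> r\<bar> \<le> sqrt \<delta> / (4 * N)" using r(1) by (simp add: c_def)
        then show "N * (4 * \<bar>\<epsilon> r\<bar>) \<le> sqrt \<delta>" using N by (simp add: field_simps)
      qed (use N in auto)
      finally show "u x 0 \<le> \<delta>" using \<delta> by simp
    qed
  qed (rule that)
  show ?thesis
  proof (rule uniform_limitI)
    fix e :: real assume "e > 0"
    then have "e\<^sup>2 > 0" by simp
    from decay[OF this] show "\<forall>\<^sub>F t in at_top. \<forall>x\<in>UNIV. dist (g t x) (mat 1) < e"
    proof eventually_elim
      case (elim t)
      then show ?case unfolding u_norm dist_norm
        using \<open>e > 0\<close> by (auto intro: power2_less_imp_less)
    qed
  qed
qed

theorem theorem1p3:
  shows "\<exists>\<epsilon>'>0. \<forall>(g :: real \<Rightarrow> 'n::finite tensor_field) (g\<^sub>0 :: 'n tensor_field) (\<epsilon> :: real \<Rightarrow> real).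
    g \<in> metrics \<infinity> {0<..} \<inter> metrics_loc 0 {0..} \<longrightarrow>
    riemannian_metric g\<^sub>0 \<longrightarrow>
    h_flow std_metric g\<^sub>0 g \<longrightarrow>
    (\<forall>t\<ge>0. close_on UNIV \<epsilon>' (g t) std_metric) \<longrightarrow>
    (\<forall>r>0. close_on (UNIV - ball 0 r) (\<epsilon> r) g\<^sub>0 std_metric) \<longrightarrow>
    (\<epsilon> \<longlongrightarrow> 0) at_top \<longrightarrow>
      ((\<lambda>t. SUP x. ereal (norm (g t x - std_metric x))) \<longlongrightarrow> 0) at_top \<and>
      (\<forall>k\<ge>1. ((\<lambda>t. SUP x. ereal (norm_nabla k (g t) x)) \<longlongrightarrow> 0) at_top)"
proof (intro exI[of _ "1 / (720 * real CARD('n) ^ 6)"] conjI allI impI)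
  let ?\<epsilon> = "1 / (720 * real CARD('n) ^ 6)"
  show "0 < ?\<epsilon>" by simp
  fix g :: "real \<Rightarrow> 'n tensor_field" and g\<^sub>0 :: "'n tensor_field" and \<epsilon> :: "real \<Rightarrow> real"
  assume g: "g \<in> metrics \<infinity> {0<..} \<inter> metrics_loc 0 {0..}"
    and "h_flow std_metric g\<^sub>0 g" "\<forall>t\<ge>0. close_on UNIV ?\<epsilon> (g t) std_metric"
    "\<forall>r>0. close_on (UNIV - ball 0 r) (\<epsilon> r) g\<^sub>0 std_metric" "(\<epsilon> \<longlongrightarrow> 0) at_top"
  then have lim: "uniform_limit UNIV g (\<lambda>_. mat 1) at_top"
    by (intro flow_tendsto_std_metric[of g g\<^sub>0 ?\<epsilon> \<epsilon>]) auto
  show "((\<lambda>t. SUP x. ereal (norm (g t x - std_metric x))) \<longlongrightarrow> 0) at_top"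
  proof (rule SUP_ereal_tendsto_zero)
    show "\<forall>\<^sub>F t in at_top. \<forall>x. norm (g t x - std_metric x) \<le> e" if "e > 0" for e
      using uniform_limitD[OF lim that]
      by eventually_elim (auto simp: std_metric_def dist_norm less_imp_le)
  qed simp
  fix k :: nat assume k: "1 \<le> k"
  show "((\<lambda>t. SUP x. ereal (norm_nabla k (g t) x)) \<longlongrightarrow> 0) at_top"
  proof (rule norm_nabla_tendsto_zero)
    fix vs :: "(real^'n) list" assume vs: "set vs \<subseteq> Basis" "length vs = k"
    define F where "F = (\<lambda>(x, t). g t x)"
    have F_slice: "(\<lambda>x. F (x, t)) = g t" for t by (simp add: F_def)
    have "Ck_on \<infinity> (UNIV \<times> {0<..}) F" using g by (simp add: metrics_def F_def)
    moreover have "vs \<noteq> []" using vs k by auto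
    ultimately show "uniform_limit UNIV (\<lambda>t. iter_deriv UNIV vs (g t)) (\<lambda>_. 0) at_top"
      using derivatives_tendsto_zero[of F "mat 1" vs, unfolded F_slice] lim vs by blast
  qed
qed

end
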